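(* For every $\chi(z)\in\mathbb C((z))$ and $(\lambda,\mu)\in\mathbb C^2$ with $\lambda\ne0$ there exists a simple $\widehat{\mathfrak{sl}_2}$-module $\overline{M_{Wak}}(\lambda,\mu,-2,\chi(z))$ (of level $-2$) realized on the space $M_1(\lambda,\mu)$ such that $$e(z)=a(z),\qquad h(z)=-2:a^*(z)a(z):+\chi(z),$$ $$f(z)=-:a^*(z)^2a(z):-2\partial_za^*(z)+a^*(z)\chi(z).$$
   Context: $\mathfrak{sl}_2$ has basis $e,f,h$ with $[e,f]=h$, $[h,e]=2e$, $[h,f]=-2f$ and form $(e,f)=1$, $(h,h)=2$ (other pairings of basis vectors zero). $\widehat{\mathfrak{sl}_2}=\mathfrak{sl}_2\otimes\mathbb C[t,t^{-1}]\oplus\mathbb Cc$, $c$ central, $x(n)=x\otimes t^n$, $[x(n),y(m)]=[x,y](n+m)+n(x,y)\delta_{n+m,0}c$. For $x\in\mathfrak{sl}_2$, $x(z)=\sum_{n\in\mathbb Z}x(n)z^{-n-1}$. Level $\kappa$ means $c$ acts as $\kappa\,\mathrm{Id}$. The Weyl algebra is the associative algebra with generators $a(n),a^*(n)$ $(n\in\mathbb Z)$ and relations $[a(n),a^*(m)]=\delta_{n+m,0}$, $[a(n),a(m)]=[a^*(n),a^*(m)]=0$. $M_1(\lambda,\mu)$ is the simple module over it generated by a vector $v_1$ with $a(0)v_1=\lambda v_1$, $a^*(1)v_1=\mu v_1$, $a(n+1)v_1=a^*(n+2)v_1=0$ for $n\ge0$. On $M_1(\lambda,\mu)$ put $a(z)=\sum_na(n)z^{-n-1}$,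 $a^*(z)=\sum_na^*(n)z^{-n}$, $a(z)^+=\sum_{n\le-1}a(n)z^{-n-1}$, $a(z)^-=\sum_{n\ge0}a(n)z^{-n-1}$, $:a^*(z)^ja(z):\;=a(z)^+a^*(z)^j+a^*(z)^ja(z)^-$ for $j=1,2$. The series $\chi(z)$ acts by multiplication by its scalar coefficients. *)

theory Defs
  imports
    "HOL-Library.Poly_Mapping"
    "HOL-Library.Product_Plus"
    "HOL-Computational_Algebra.Formal_Laurent_Series"
begin

section \<open>The affine Lie algebra of type sl(2)\<close>

text \<open>The triple \<open>(x, y, z)\<close> stands for \<open>x e + y h + z f\<close>.\<close>

type_synonym sl2 = "complex \<times> complex \<times> complex"

definition sl2_e :: sl2 where "sl2_e = (1, 0, 0)"
definition sl2_h :: sl2 where "sl2_h = (0, 1, 0)"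
definition sl2_f :: sl2 where "sl2_f = (0, 0, 1)"

fun sl2_scale :: "complex \<Rightarrow> sl2 \<Rightarrow> sl2" where
  "sl2_scale s (x, y, z) = (s * x, s * y, s * z)"

fun sl2_bracket :: "sl2 \<Rightarrow> sl2 \<Rightarrow> sl2" where
  "sl2_bracket (x, y, z) (x', y', z') =
     (2 * (y * x' - x * y'), x * z' - z * x', -2 * (y * z' - z * y'))"

fun sl2_form :: "sl2 \<Rightarrow> sl2 \<Rightarrow> complex" where
  "sl2_form (x, y, z) (x', y', z') = x * z' + z * x' + 2 * y * y'"

lemma sl2_relations:
  "sl2_bracket sl2_e sl2_f = sl2_h"
  "sl2_bracket sl2_h sl2_e = sl2_scale 2 sl2_e"
  "sl2_bracket sl2_h sl2_f = sl2_scale (-2) sl2_f"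
  "sl2_form sl2_e sl2_f = 1" "sl2_form sl2_h sl2_h = 2"
  "sl2_form sl2_e sl2_e = 0" "sl2_form sl2_f sl2_f = 0"
  "sl2_form sl2_h sl2_e = 0" "sl2_form sl2_h sl2_f = 0"
  by (simp_all add: sl2_e_def sl2_f_def sl2_h_def)

lemma sl2_bracket_zero [simp]: "sl2_bracket 0 y = 0" "sl2_bracket x 0 = 0"
  subgoal by (cases y) (simp add: zero_prod_def)
  subgoal by (cases x) (simp add: zero_prod_def)
  done

lemma sl2_form_zero [simp]: "sl2_form 0 y = 0" "sl2_form x 0 = 0"
  subgoal by (cases y) (simp add: zero_prod_def)
  subgoal by (cases x) (simp add: zero_prod_def)
  done

text \<open>
  The tensor product of sl(2) with the Laurent polynomials in \<open>t\<close> is the space of Laurent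
  polynomials with coefficients in sl(2): the coefficient at \<open>n\<close> is that of \<open>t\<^sup>n\<close>.
  The second component is the coefficient of \<open>c\<close>.
\<close>

type_synonym affine_sl2 = "(int \<Rightarrow>\<^sub>0 sl2) \<times> complex"

definition aff_elem :: "sl2 \<Rightarrow> int \<Rightarrow> affine_sl2" where
  "aff_elem x n = (Poly_Mapping.single n x, 0)"

definition aff_c :: affine_sl2 where
  "aff_c = (0, 1)"

fun aff_scale :: "complex \<Rightarrow> affine_sl2 \<Rightarrow> affine_sl2" where
  "aff_scale s (p, r) = (Poly_Mapping.map (sl2_scale s) p, s * r)"

fun aff_bracket :: "affine_sl2 \<Rightarrow> affine_sl2 \<Rightarrow> affine_sl2" where
  "aff_bracket (p, r) (q, s) =
     (\<Sum>n\<in>Poly_Mapping.keys p. \<Sum>m\<in>Poly_Mapping.keys q.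
        Poly_Mapping.single (n + m)
          (sl2_bracket (Poly_Mapping.lookup p n) (Poly_Mapping.lookup q m)),
      \<Sum>n\<in>Poly_Mapping.keys p.
        of_int n * sl2_form (Poly_Mapping.lookup p n) (Poly_Mapping.lookup q (- n)))"

lemma aff_bracket_elem:
  "aff_bracket (aff_elem x n) (aff_elem y m) =
     aff_elem (sl2_bracket x y) (n + m) +
     aff_scale (of_int n * sl2_form x y * (if n + m = 0 then 1 else 0)) aff_c"
proof -
  have [simp]: "Poly_Mapping.map f (0 :: int \<Rightarrow>\<^sub>0 sl2) = 0" for f :: "sl2 \<Rightarrow> sl2"
    by (simp add: map_eq_zero_iff)
  let ?x = "Poly_Mapping.single n x" and ?y = "Poly_Mapping.single m y"
  have "(\<Sum>i\<in>Poly_Mapping.keys ?x. \<Sum>j\<in>Poly_Mapping.keys ?y.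
            Poly_Mapping.single (i + j)
              (sl2_bracket (Poly_Mapping.lookup ?x i) (Poly_Mapping.lookup ?y j))) =
        Poly_Mapping.single (n + m) (sl2_bracket x y)"
    by (cases "x = 0"; cases "y = 0") simp_all
  moreover have "(\<Sum>i\<in>Poly_Mapping.keys ?x.
            of_int i * sl2_form (Poly_Mapping.lookup ?x i) (Poly_Mapping.lookup ?y (- i))) =
        of_int n * sl2_form x y * (if n + m = 0 then 1 else 0)"
  proof (cases "m = - n")
    case True
    then show ?thesis by (cases "x = 0") simp_all
  next
    case False
    then have "Poly_Mapping.lookup ?y (- n) = 0" "n + m \<noteq> 0"
      by (auto simp: lookup_single when_def)
    then show ?thesis by (cases "x = 0") simp_all
  qed
  ultimately show ?thesis
    by (simp only: aff_elem_def aff_c_def aff_bracket.simps aff_scale.simps) simp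
qed

lemma aff_bracket_central:
  "aff_bracket aff_c x = 0" "aff_bracket x aff_c = 0"
  subgoal by (cases x, hypsubst, simp add: aff_c_def prod_eq_iff)
  subgoal by (cases x, hypsubst, simp add: aff_c_def prod_eq_iff)
  done

section \<open>Modules\<close>

definition invariant_subspace ::
    "(complex \<Rightarrow> 'v::ab_group_add \<Rightarrow> 'v) \<Rightarrow> ('v \<Rightarrow> 'v) set \<Rightarrow> 'v set \<Rightarrow> bool" where
  "invariant_subspace scale T W \<longleftrightarrow>
     module.subspace scale W \<and> (\<forall>g\<in>T. \<forall>w\<in>W. g w \<in> W)"

definition simple_under ::
    "(complex \<Rightarrow> 'v::ab_group_add \<Rightarrow> 'v) \<Rightarrow> ('v \<Rightarrow> 'v) set \<Rightarrow> bool" where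
  "simple_under scale T \<longleftrightarrow>
     (UNIV :: 'v set) \<noteq> {0} \<and>
     (\<forall>W. invariant_subspace scale T W \<longrightarrow> W = {0} \<or> W = UNIV)"

locale affine_sl2_module = vector_space scale
  for scale :: "complex \<Rightarrow> 'v::ab_group_add \<Rightarrow> 'v" +
  fixes \<rho> :: "affine_sl2 \<Rightarrow> 'v \<Rightarrow> 'v"
  assumes linear_action: "Vector_Spaces.linear scale scale (\<rho> x)"
    and action_add: "\<rho> (x + y) v = \<rho> x v + \<rho> y v"
    and action_scale: "\<rho> (aff_scale s x) v = scale s (\<rho> x v)"
    and action_bracket: "\<rho> (aff_bracket x y) v = \<rho> x (\<rho> y v) - \<rho> y (\<rho> x v)"

definition has_level ::
    "(complex \<Rightarrow> 'v \<Rightarrow> 'v) \<Rightarrow> (affine_sl2 \<Rightarrow> 'v \<Rightarrow> 'v) \<Rightarrow> complex \<Rightarrow> bool" where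
  "has_level scale \<rho> \<kappa> \<longleftrightarrow> (\<forall>v. \<rho> aff_c v = scale \<kappa> v)"

text \<open>
  A module over the Weyl algebra, which is given by generators and relations, is a vector
  space with operators \<open>a(n)\<close>, \<open>a\<^sup>*(n)\<close> satisfying the relations; its submodules are the
  subspaces stable under all these operators.
\<close>

locale weyl_module = vector_space scale
  for scale :: "complex \<Rightarrow> 'v::ab_group_add \<Rightarrow> 'v" +
  fixes a astar :: "int \<Rightarrow> 'v \<Rightarrow> 'v"
  assumes linear_a: "Vector_Spaces.linear scale scale (a n)"
    and linear_astar: "Vector_Spaces.linear scale scale (astar n)"
    and a_astar: "a n (astar m v) - astar m (a n v) = (if n + m = 0 then v else 0)"
    and a_a: "a n (a m v) - a m (a n v) = 0"
    and astar_astar: "astar n (astar m v) - astar m (astar n v) = 0"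

text \<open>
  \<open>M1 scale a astar v\<^sub>1 lam mu\<close> says that the type \<open>'v\<close> with these operations and the vector
  \<open>v\<^sub>1\<close> is a copy of \<open>M\<^sub>1(lam, mu)\<close>, which is determined up to isomorphism.
\<close>

locale M1 = weyl_module scale a astar
  for scale :: "complex \<Rightarrow> 'v::ab_group_add \<Rightarrow> 'v" and a astar :: "int \<Rightarrow> 'v \<Rightarrow> 'v" +
  fixes v\<^sub>1 :: 'v and lam mu :: complex
  assumes simple: "simple_under scale (range a \<union> range astar)"
    and generated: "invariant_subspace scale (range a \<union> range astar) W \<Longrightarrow> v\<^sub>1 \<in> W \<Longrightarrow> W = UNIV"
    and a_0: "a 0 v\<^sub>1 = scale lam v\<^sub>1"
    and astar_1: "astar 1 v\<^sub>1 = scale mu v\<^sub>1"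
    and a_pos: "n \<ge> 0 \<Longrightarrow> a (n + 1) v\<^sub>1 = 0"
    and astar_pos: "n \<ge> 0 \<Longrightarrow> astar (n + 2) v\<^sub>1 = 0"

section \<open>Formal distributions\<close>

text \<open>A formal distribution \<open>A(z)\<close> is the function mapping \<open>k\<close> to its coefficient of \<open>z\<^sup>k\<close>.\<close>

type_synonym 'v fdist = "int \<Rightarrow> 'v \<Rightarrow> 'v"

text \<open>
  \<open>Sum_any\<close> sums over the support and is 0 if that is infinite. In the products below
  all supports are finite, because every vector of \<open>M\<^sub>1(lam, mu)\<close> is killed by \<open>a(n)\<close> and
  \<open>a\<^sup>*(n)\<close> for all large \<open>n\<close> (see \<open>M1_smooth\<close>).
\<close>

definition fd_mult :: "'v::ab_group_add fdist \<Rightarrow> 'v fdist \<Rightarrow> 'v fdist" where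
  "fd_mult A B k v = Sum_any (\<lambda>i. A i (B (k - i) v))"

definition fd_one :: "'v::ab_group_add fdist" where
  "fd_one k v = (if k = 0 then v else 0)"

fun fd_power :: "'v::ab_group_add fdist \<Rightarrow> nat \<Rightarrow> 'v fdist" where
  "fd_power A 0 = fd_one"
| "fd_power A (Suc j) = fd_mult A (fd_power A j)"

definition fd_deriv :: "(complex \<Rightarrow> 'v \<Rightarrow> 'v) \<Rightarrow> 'v fdist \<Rightarrow> 'v fdist" where
  "fd_deriv scale A k v = scale (of_int (k + 1)) (A (k + 1) v)"

definition fd_scalar :: "(complex \<Rightarrow> 'v \<Rightarrow> 'v) \<Rightarrow> complex fls \<Rightarrow> 'v fdist" where
  "fd_scalar scale chi k v = scale (fls_nth chi k) v"

definition current :: "(affine_sl2 \<Rightarrow> 'v \<Rightarrow> 'v) \<Rightarrow> sl2 \<Rightarrow> 'v fdist" where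
  "current \<rho> x k = \<rho> (aff_elem x (- k - 1))"

definition a_field :: "(int \<Rightarrow> 'v \<Rightarrow> 'v) \<Rightarrow> 'v fdist" where
  "a_field a k = a (- k - 1)"

definition astar_field :: "(int \<Rightarrow> 'v \<Rightarrow> 'v) \<Rightarrow> 'v fdist" where
  "astar_field astar k = astar (- k)"

text \<open>In the parts of \<open>a(z)\<close>, the condition \<open>n \<le> -1\<close> reads \<open>k \<ge> 0\<close> for \<open>k = -n - 1\<close>.\<close>

definition a_plus :: "(int \<Rightarrow> 'v \<Rightarrow> 'v) \<Rightarrow> 'v::ab_group_add fdist" where
  "a_plus a k v = (if k \<ge> 0 then a_field a k v else 0)"

definition a_minus :: "(int \<Rightarrow> 'v \<Rightarrow> 'v) \<Rightarrow> 'v::ab_group_add fdist" where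
  "a_minus a k v = (if k < 0 then a_field a k v else 0)"

definition normal_ordered ::
    "(int \<Rightarrow> 'v \<Rightarrow> 'v) \<Rightarrow> (int \<Rightarrow> 'v \<Rightarrow> 'v) \<Rightarrow> nat \<Rightarrow> 'v::ab_group_add fdist" where
  "normal_ordered a astar j k v =
     fd_mult (a_plus a) (fd_power (astar_field astar) j) k v +
     fd_mult (fd_power (astar_field astar) j) (a_minus a) k v"

lemma (in M1) M1_smooth: "\<exists>N. \<forall>n\<ge>N. a n v = 0 \<and> astar n v = 0"
proof -
  interpret la: module_hom scale scale "a n" for n
    using linear_a by (simp add: Vector_Spaces.linear_def)
  interpret ls: module_hom scale scale "astar n" for n
    using linear_astar by (simp add: Vector_Spaces.linear_def)
  define W where "W = {v. \<exists>N. \<forall>n\<ge>N. a n v = 0 \<and> astar n v = 0}"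
  have W: "v \<in> W" if "\<And>n. n \<ge> N \<Longrightarrow> a n v = 0 \<and> astar n v = 0" for v N
    using that unfolding W_def by blast
  have "subspace W"
  proof (rule subspaceI)
    show "0 \<in> W" by (rule W) (simp add: la.zero ls.zero)
  next
    fix x y assume "x \<in> W" "y \<in> W"
    then obtain N M where "\<forall>n\<ge>N. a n x = 0 \<and> astar n x = 0" "\<forall>n\<ge>M. a n y = 0 \<and> astar n y = 0"
      unfolding W_def by blast
    then show "x + y \<in> W" by (intro W[of "max N M"]) (simp add: la.add ls.add)
  next
    fix s x assume "x \<in> W"
    then obtain N where "\<forall>n\<ge>N. a n x = 0 \<and> astar n x = 0" unfolding W_def by blast
    then show "scale s x \<in> W" by (intro W[of N]) (simp add: la.scale ls.scale)
  qed
  moreover have "a m x \<in> W \<and> astar m x \<in> W" if "x \<in> W" for m x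
  proof -
    obtain N where N: "\<And>n. n \<ge> N \<Longrightarrow> a n x = 0 \<and> astar n x = 0"
      using \<open>x \<in> W\<close> unfolding W_def by blast
    have "a n (a m x) = 0 \<and> astar n (a m x) = 0" if "n \<ge> max N (1 - m)" for n
      using that N[of n] a_a[of n m x] a_astar[of m n x] by (simp add: la.zero)
    moreover have "a n (astar m x) = 0 \<and> astar n (astar m x) = 0" if "n \<ge> max N (1 - m)" for n
      using that N[of n] a_astar[of n m x] astar_astar[of n m x] by (simp add: ls.zero)
    ultimately show ?thesis using W by blast
  qed
  moreover have "v\<^sub>1 \<in> W"
  proof (rule W)
    fix n :: int assume "n \<ge> 2"
    then show "a n v\<^sub>1 = 0 \<and> astar n v\<^sub>1 = 0"
      using a_pos[of "n - 1"] astar_pos[of "n - 2"] by simp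
  qed
  ultimately have "W = UNIV"
    by (intro generated) (auto simp: invariant_subspace_def)
  then show ?thesis unfolding W_def by blast
qed

end

theory Submission imports Defs begin

text \<open>
  The proof has two independent halves: the given series satisfy the relations of the affine
  algebra at level \<open>-2\<close>, which holds on every smooth module over the Weyl algebra, and the
  resulting module is simple, which uses \<open>M\<^sub>1(\<lambda>, \<mu>)\<close> and \<open>\<lambda> \<noteq> 0\<close>.
  
  Relations. Write \<open>\<alpha> = a(z)\<close>, \<open>\<beta> = a\<^sup>*(z)\<close>, \<open>\<gamma> = \<beta>\<beta>\<close> and \<open>b = :\<beta>\<alpha>:\<close>. The commutators of the
  currents with \<open>\<alpha>\<close> and \<open>\<beta>\<close> have one factor less and are easy to read off termwise. Among the
  other commutators only \<open>[b, b]\<close> has to be resummed by hand; its central term counts the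
  terms that change their normal ordering under a shift of the summation index
  (\<open>commutator_b_b\<close>). For \<open>[h, f]\<close> and \<open>[f, f]\<close> let \<open>C\<close> be the difference of the two sides of the
  expected relation. The Jacobi identity shows that \<open>C\<close> commutes with the Weyl algebra, hence also
  with the charge operator \<open>b(0)\<close>, since that is a locally finite sum of products of Weyl
  generators. On the other hand \<open>C\<close> has charge 1 or 2, that is, \<open>[b(0), C] = cC\<close> with \<open>c \<noteq> 0\<close>.
  So \<open>C = 0\<close> (\<open>weight_nonzero_imp_zero\<close>); no multiple sum of normally ordered monomials has to be
  rearranged.
  
  Simplicity. A submodule \<open>W\<close> is stable under \<open>\<alpha>\<close>, which is \<open>e(z)\<close>, and under \<open>b\<close>, which is
  \<open>-h(z)/2\<close> up to scalar operators. The coefficient of \<open>b\<close> that contains \<open>a\<^sup>*(n) a(0)\<close> is, on a vector on which \<open>a(0)\<close> acts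
  by \<open>\<lambda>\<close> and all \<open>a(m)\<close> with \<open>m > 0\<close> by 0, equal to \<open>\<lambda> a\<^sup>*(n)\<close> plus terms \<open>a(n - k) a\<^sup>*(k)\<close> with
  \<open>k > n\<close>. As \<open>a\<^sup>*(k)\<close> kills the vector for large \<open>k\<close>, descending induction on \<open>n\<close> recovers each
  \<open>a\<^sup>*(n)\<close> from operators that preserve \<open>W\<close>. Every vector of \<open>M\<^sub>1(\<lambda>, \<mu>)\<close> is killed by all products
  of sufficiently many operators \<open>a(m) - \<lambda>\<delta>\<^bsub>m,0\<^esub>\<close> with \<open>m \<ge> 0\<close>, and an outer induction on the number of factors
  reduces the general case to the same argument (\<open>beta_stable_if_alpha_b_stable\<close>). So \<open>W\<close> is a
  Weyl submodule, and these are trivial by the simplicity of \<open>M\<^sub>1(\<lambda>, \<mu>)\<close>.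
  
  All series are indexed by the power of \<open>z\<close>. The mode \<open>x(n)\<close> of a current is the coefficient of
  \<open>z\<^sup>k\<close> with \<open>k = -n - 1\<close>, so the sum \<open>m + n\<close> of modes turns into \<open>k + l + 1\<close>, the mode 0 into the index \<open>-1\<close>, and
  \<open>m + n = 0\<close> into \<open>k + l = -2\<close>.
\<close>

section \<open>Finitely supported sums over the integers\<close>

lemma Sum_any_shift: "Sum_any (\<lambda>i::int. f (i + s)) = Sum_any f"
  using Sum_any.reindex_cong[OF bij_plus_right[of s], of f] by (simp add: comp_def)

lemma Sum_any_reflect: "Sum_any (\<lambda>i::int. f (k - i)) = Sum_any f"
proof -
  have "bij ((-) k)" by (rule o_bij[of "(-) k"]) auto
  from Sum_any.reindex_cong[OF this, of f] show ?thesis by (simp add: comp_def)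
qed

lemma Sum_any_diff:
  fixes f g :: "'b \<Rightarrow> 'a::ab_group_add"
  assumes "finite {i. f i \<noteq> 0}" "finite {i. g i \<noteq> 0}"
  shows "Sum_any (\<lambda>i. f i - g i) = Sum_any f - Sum_any g"
proof -
  let ?S = "{i. f i \<noteq> 0} \<union> {i. g i \<noteq> 0}"
  have "Sum_any f = sum f ?S" "Sum_any g = sum g ?S"
    "Sum_any (\<lambda>i. f i - g i) = sum (\<lambda>i. f i - g i) ?S"
    using assms by (auto intro!: Sum_any.expand_superset)
  then show ?thesis by (simp add: sum_subtractf)
qed

section \<open>Linear operators and commutators\<close>

definition commutator :: "('v \<Rightarrow> 'v) \<Rightarrow> ('v \<Rightarrow> 'v) \<Rightarrow> 'v \<Rightarrow> 'v::ab_group_add" where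
  "commutator D E v = D (E v) - E (D v)"

locale complex_vector_space = vector_space scale
  for scale :: "complex \<Rightarrow> 'v::ab_group_add \<Rightarrow> 'v"
begin

abbreviation linear_op :: "('v \<Rightarrow> 'v) \<Rightarrow> bool" where
  "linear_op \<equiv> Vector_Spaces.linear scale scale"

lemma linear_opI:
  assumes "\<And>u v. D (u + v) = D u + D v" "\<And>c v. D (scale c v) = scale c (D v)"
  shows "linear_op D"
  using assms by (simp add: Vector_Spaces.linear_iff vector_space_axioms)

lemma linear_op_simps:
  assumes "linear_op D"
  shows "D (u + v) = D u + D v" "D (scale c v) = scale c (D v)" "D 0 = 0"
    "D (u - v) = D u - D v" "D (- v) = - D v" "D (sum f A) = (\<Sum>x\<in>A. D (f x))"
proof -
  interpret module_hom scale scale D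
    using assms by (simp add: Vector_Spaces.linear_def)
  show "D (u + v) = D u + D v" "D (scale c v) = scale c (D v)" "D 0 = 0"
    "D (u - v) = D u - D v" "D (- v) = - D v" "D (sum f A) = (\<Sum>x\<in>A. D (f x))"
    by (rule add scale zero diff neg sum)+
qed

lemma linear_op_intros:
  assumes "linear_op D" "linear_op E"
  shows "linear_op (\<lambda>v. D v + E v)" "linear_op (\<lambda>v. D v - E v)"
    "linear_op (\<lambda>v. D (E v))" "linear_op (commutator D E)"
  using assms
  by (auto intro!: linear_opI simp: commutator_def linear_op_simps scale_right_distrib
      scale_right_diff_distrib scale_left_commute)

lemma linear_op_intros_unary:
  assumes "linear_op D"
  shows "linear_op (\<lambda>v. scale c (D v))" "linear_op (\<lambda>v. - D v)"
  using assms
  by (auto intro!: linear_opI simp: linear_op_simps scale_right_distrib scale_left_commute)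

lemma linear_op_trivial: "linear_op (\<lambda>v. 0)" "linear_op (\<lambda>v. scale c v)"
  by (auto intro!: linear_opI simp: scale_right_distrib scale_left_commute)

lemma linear_op_Sum_any:
  assumes "\<And>i. linear_op (T i)" "\<And>v. finite {i. T i v \<noteq> 0}"
  shows "linear_op (\<lambda>v. Sum_any (\<lambda>i. T i v))"
proof (rule linear_opI)
  fix u v
  show "Sum_any (\<lambda>i. T i (u + v)) = Sum_any (\<lambda>i. T i u) + Sum_any (\<lambda>i. T i v)"
    using assms by (simp add: linear_op_simps Sum_any.distrib)
next
  fix c v
  have "Sum_any (\<lambda>i. T i (scale c v)) = (\<Sum>i\<in>{i. T i v \<noteq> 0}. T i (scale c v))"
    using assms by (intro Sum_any.expand_superset) (auto simp: linear_op_simps)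
  then show "Sum_any (\<lambda>i. T i (scale c v)) = scale c (Sum_any (\<lambda>i. T i v))"
    using assms by (simp add: Sum_any.expand_set linear_op_simps scale_sum_right)
qed

lemma linear_op_apply_Sum_any:
  assumes "linear_op D" "finite {i. f i \<noteq> 0}"
  shows "D (Sum_any f) = Sum_any (\<lambda>i. D (f i))"
proof -
  have "Sum_any (\<lambda>i. D (f i)) = (\<Sum>i\<in>{i. f i \<noteq> 0}. D (f i))"
    using assms by (intro Sum_any.expand_superset) (auto simp: linear_op_simps)
  then show ?thesis using assms by (simp add: Sum_any.expand_set linear_op_simps)
qed

lemma commutator_Sum_any:
  assumes D: "linear_op D" and fin: "\<And>v. finite {i. T i v \<noteq> 0}"
  shows "commutator D (\<lambda>v. Sum_any (\<lambda>i. T i v)) v = Sum_any (\<lambda>i. commutator D (T i) v)"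
proof -
  have "finite {i. D (T i v) \<noteq> 0}"
    by (rule finite_subset[OF _ fin[of v]]) (auto simp: linear_op_simps[OF D])
  then show ?thesis
    using D fin by (simp add: commutator_def linear_op_apply_Sum_any Sum_any_diff)
qed

lemma commutator_jacobi:
  assumes "linear_op D" "linear_op E" "linear_op F"
  shows "commutator D (commutator E F) v =
    commutator (commutator D E) F v + commutator E (commutator D F) v"
  using assms by (simp add: commutator_def linear_op_simps)

lemma commutator_skew: "commutator D E v = - commutator E D v"
  by (simp add: commutator_def)

lemma commutator_right:
  assumes "linear_op D"
  shows "commutator D (\<lambda>v. E v + F v) v = commutator D E v + commutator D F v"
    "commutator D (\<lambda>v. E v - F v) v = commutator D E v - commutator D F v"
    "commutator D (\<lambda>v. scale c (E v)) v = scale c (commutator D E v)"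
    "commutator D (\<lambda>v. - E v) v = - commutator D E v"
    "commutator D (\<lambda>v. scale c v) v = 0" "commutator D (\<lambda>v. v) v = 0"
  using assms by (simp_all add: commutator_def linear_op_simps scale_right_diff_distrib)

lemma commutator_left:
  assumes "linear_op D"
  shows "commutator (\<lambda>v. E v + F v) D v = commutator E D v + commutator F D v"
    "commutator (\<lambda>v. E v - F v) D v = commutator E D v - commutator F D v"
    "commutator (\<lambda>v. scale c (E v)) D v = scale c (commutator E D v)"
    "commutator (\<lambda>v. - E v) D v = - commutator E D v"
    "commutator (\<lambda>v. scale c v) D v = 0" "commutator (\<lambda>v. v) D v = 0"
    "commutator (\<lambda>v. 0) D v = 0"
  using assms by (simp_all add: commutator_def linear_op_simps scale_right_diff_distrib)

end

section \<open>Fields\<close>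

context complex_vector_space
begin

text \<open>
  Fields in the sense of vertex algebras: operator-valued series that become Laurent series in \<open>z\<close>
  when applied to a vector.
\<close>

definition is_field :: "'v fdist \<Rightarrow> bool" where
  "is_field P \<longleftrightarrow> (\<forall>k. linear_op (P k)) \<and> (\<forall>v. \<exists>N. \<forall>k<N. P k v = 0)"

lemma is_field_zero_arg: "is_field P \<Longrightarrow> P k 0 = 0"
  by (simp add: is_field_def linear_op_simps(3))

lemma is_field_linear: "is_field P \<Longrightarrow> linear_op (P k)"
  by (simp add: is_field_def)

lemma is_field_bound:
  assumes "is_field P"
  obtains N where "\<And>k. k < N \<Longrightarrow> P k v = 0"
  using assms unfolding is_field_def by blast

definition commuting :: "'v fdist \<Rightarrow> 'v fdist \<Rightarrow> bool" where
  "commuting P Q \<longleftrightarrow> (\<forall>i j v. P i (Q j v) = Q j (P i v))"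

lemma commuting_sym: "commuting P Q \<Longrightarrow> commuting Q P"
  by (simp add: commuting_def)

text \<open>
  Applied to \<open>v\<close>, the factor \<open>Q\<close> bounds the summation index from above. The bound from below comes
  from moving \<open>P\<close> to the right, next to \<open>v\<close>; for fields that do not commute the sum is infinite in
  general, which is why normal ordering is needed elsewhere.
\<close>

lemma finite_support_mult:
  assumes "is_field P" "is_field Q" "commuting P Q"
  shows "finite {i. P i (Q (k - i) v) \<noteq> 0}"
proof -
  obtain N where N: "\<And>i. i < N \<Longrightarrow> P i v = 0" using is_field_bound[OF assms(1)] by blast
  obtain M where M: "\<And>i. i < M \<Longrightarrow> Q i v = 0" using is_field_bound[OF assms(2)] by blast
  have "P i (Q (k - i) v) = 0" if "i < N \<or> i > k - M" for i
  proof (cases "i < N")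
    case True
    then show ?thesis using assms N[of i]
      by (simp add: commuting_def is_field_zero_arg[OF assms(2)])
  next
    case False
    then show ?thesis using that M[of "k - i"]
      by (simp add: is_field_zero_arg[OF assms(1)])
  qed
  then have "{i. P i (Q (k - i) v) \<noteq> 0} \<subseteq> {N..k - M}" by (force simp: not_less[symmetric])
  then show ?thesis by (rule finite_subset) simp
qed

lemma is_field_mult:
  assumes "is_field P" "is_field Q" "commuting P Q"
  shows "is_field (fd_mult P Q)"
  unfolding is_field_def
proof (intro conjI allI)
  fix k
  show "linear_op (fd_mult P Q k)"
    unfolding fd_mult_def
    by (rule linear_op_Sum_any[OF linear_op_intros(3)[OF is_field_linear[OF assms(1)]
          is_field_linear[OF assms(2)]] finite_support_mult[OF assms]])
next
  fix v
  obtain N where N: "\<And>i. i < N \<Longrightarrow> P i v = 0" using is_field_bound[OF assms(1)] by blast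
  obtain M where M: "\<And>i. i < M \<Longrightarrow> Q i v = 0" using is_field_bound[OF assms(2)] by blast
  have "P i (Q (k - i) v) = 0" if "k < N + M" for i k
  proof (cases "i < N")
    case True
    then show ?thesis using assms N[of i]
      by (simp add: commuting_def is_field_zero_arg[OF assms(2)])
  next
    case False
    then show ?thesis using that M[of "k - i"]
      by (simp add: is_field_zero_arg[OF assms(1)])
  qed
  then show "\<exists>N. \<forall>k<N. fd_mult P Q k v = 0"
    by (intro exI[of _ "N + M"]) (simp add: fd_mult_def)
qed

lemma fd_mult_commute:
  assumes "commuting P Q"
  shows "fd_mult P Q = fd_mult Q P"
proof (intro ext)
  fix k v
  have "P i (Q (k - i) v) = Q (k - i) (P (k - (k - i)) v)" for i
    using assms by (simp add: commuting_def)
  then show "fd_mult P Q k v = fd_mult Q P k v"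
    unfolding fd_mult_def using Sum_any_reflect[of "\<lambda>i. Q i (P (k - i) v)" k] by simp
qed

lemma commuting_mult:
  assumes "is_field P" "is_field Q" "is_field R" "commuting P Q" "commuting R P" "commuting R Q"
  shows "commuting R (fd_mult P Q)"
  unfolding commuting_def
proof (intro allI)
  fix i k v
  have "R i (P j (Q (k - j) v)) = P j (Q (k - j) (R i v))" for j
    using assms(5,6) by (simp add: commuting_def)
  then show "R i (fd_mult P Q k v) = fd_mult P Q k (R i v)"
    unfolding fd_mult_def
    using linear_op_apply_Sum_any[OF is_field_linear[OF assms(3)]
        finite_support_mult[OF assms(1,2,4)], of i k v]
    by simp
qed

text \<open>
  The Leibniz rule for a derivation that shifts the degree in \<open>z\<close> by \<open>s\<close>.
\<close>

lemma commutator_mult: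
  assumes D: "linear_op D" and P: "is_field P" and Q: "is_field Q"
    and P': "is_field P'" and Q': "is_field Q'"
    and c: "commuting P Q" "commuting P' Q" "commuting P Q'"
    and DP: "\<And>k v. commutator D (P k) v = P' (k + s) v"
    and DQ: "\<And>k v. commutator D (Q k) v = Q' (k + s) v"
  shows "commutator D (fd_mult P Q k) v = fd_mult P' Q (k + s) v + fd_mult P Q' (k + s) v"
proof -
  have 1: "commutator D (\<lambda>v. P i (Q (k - i) v)) v =
      P' (i + s) (Q (k + s - (i + s)) v) + P i (Q' (k + s - i) v)" for i
  proof -
    have "commutator D (\<lambda>v. P i (Q (k - i) v)) v =
        commutator D (P i) (Q (k - i) v) + P i (commutator D (Q (k - i)) v)"
      unfolding commutator_def linear_op_simps(4)[OF is_field_linear[OF P]] by simp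
    then show ?thesis unfolding DP DQ by (simp add: algebra_simps)
  qed
  have fin: "finite {i. P' (i + s) (Q (k + s - (i + s)) v) \<noteq> 0}"
    using finite_vimageI[OF finite_support_mult[OF P' Q c(2), of "k + s" v] inj_on_add', of s]
    by (simp only: vimage_def mem_Collect_eq)
  have "commutator D (fd_mult P Q k) v = Sum_any (\<lambda>i. commutator D (\<lambda>v. P i (Q (k - i) v)) v)"
    using commutator_Sum_any[OF D finite_support_mult[OF P Q c(1), of k]]
    by (simp add: fd_mult_def[abs_def])
  also have "\<dots> = Sum_any (\<lambda>i. P' (i + s) (Q (k + s - (i + s)) v)) +
      Sum_any (\<lambda>i. P i (Q' (k + s - i) v))"
    unfolding 1 by (rule Sum_any.distrib[OF fin finite_support_mult[OF P Q' c(3)]])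
  also have "\<dots> = fd_mult P' Q (k + s) v + fd_mult P Q' (k + s) v"
    using Sum_any_shift[of "\<lambda>i. P' i (Q (k + s - i) v)" s] by (simp add: fd_mult_def)
  finally show ?thesis .
qed

lemma fd_mult_zero_right:
  assumes "is_field P"
  shows "fd_mult P (\<lambda>k v. 0) k v = 0"
  by (simp add: fd_mult_def is_field_zero_arg[OF assms])

lemma fd_mult_one_right:
  assumes "is_field P"
  shows "fd_mult P fd_one = P"
proof (intro ext)
  fix k v
  have "Sum_any (\<lambda>i. P i (if k - i = 0 then v else 0)) =
      (\<Sum>i\<in>{k}. P i (if k - i = 0 then v else 0))"
    by (rule Sum_any.expand_superset)
      (auto simp: is_field_zero_arg[OF assms])
  then show "fd_mult P fd_one k v = P k v" by (simp add: fd_mult_def fd_one_def)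
qed

lemma is_field_zero: "is_field (\<lambda>k v. 0)"
  by (simp add: is_field_def linear_op_trivial)

lemma is_field_one: "is_field fd_one"
proof -
  have "linear_op (fd_one k)" for k by (rule linear_opI) (simp_all add: fd_one_def)
  then show ?thesis by (auto simp: is_field_def fd_one_def intro!: exI[of _ 0])
qed

lemma is_field_minus: "is_field P \<Longrightarrow> is_field (\<lambda>k v. - P k v)"
  by (simp add: is_field_def linear_op_intros_unary(2))

lemma is_field_scalar: "is_field (fd_scalar scale chi)"
proof -
  have "linear_op (fd_scalar scale chi k)" for k
    by (rule linear_opI) (simp_all add: fd_scalar_def scale_right_distrib scale_left_commute)
  then show ?thesis
    by (auto simp: is_field_def fd_scalar_def intro!: exI[of _ "fls_subdegree chi"])
qed

lemma commuting_scalar: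
  assumes "is_field P"
  shows "commuting P (fd_scalar scale chi)"
  by (simp add: commuting_def fd_scalar_def linear_op_simps(2)[OF is_field_linear[OF assms]])

lemma commuting_one:
  assumes "is_field P"
  shows "commuting P fd_one"
  by (simp add: commuting_def fd_one_def is_field_zero_arg[OF assms])

lemma commuting_zero:
  assumes "is_field P"
  shows "commuting P (\<lambda>k v. 0)"
  by (simp add: commuting_def is_field_zero_arg[OF assms])

end

section \<open>Normally ordered products in smooth Weyl modules\<close>

text \<open>
  Normal ordering of \<open>P(z) a(z)\<close> for an arbitrary series \<open>P\<close> in place of a power of \<open>a\<^sup>*(z)\<close>: the
  commutator with \<open>\<alpha>\<close> turns \<open>a\<^sup>*(z)\<^sup>j\<close> into a multiple of \<open>a\<^sup>*(z)\<^bsup>j-1\<^esup>\<close>, so treating all \<open>P\<close> at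
  once covers \<open>\<alpha>\<close>, \<open>b\<close> and the cubic term of \<open>f(z)\<close>.
\<close>

definition normal_product :: "(int \<Rightarrow> 'v \<Rightarrow> 'v) \<Rightarrow> 'v fdist \<Rightarrow> 'v::ab_group_add fdist" where
  "normal_product a P k v = fd_mult (a_plus a) P k v + fd_mult P (a_minus a) k v"

lemma normal_ordered_eq:
  "normal_ordered a astar j = normal_product a (fd_power (astar_field astar) j)"
  by (intro ext) (simp add: normal_ordered_def normal_product_def)

locale smooth_weyl_module = weyl_module scale a astar
  for scale :: "complex \<Rightarrow> 'v::ab_group_add \<Rightarrow> 'v" and a astar :: "int \<Rightarrow> 'v \<Rightarrow> 'v" +
  assumes smooth: "\<exists>N. \<forall>n\<ge>N. a n v = 0 \<and> astar n v = 0"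
begin

sublocale complex_vector_space scale ..

abbreviation \<alpha> :: "'v fdist" where "\<alpha> \<equiv> a_field a"
abbreviation \<beta> :: "'v fdist" where "\<beta> \<equiv> astar_field astar"
abbreviation \<gamma> :: "'v fdist" where "\<gamma> \<equiv> fd_mult \<beta> \<beta>"

lemma is_field_alpha: "is_field \<alpha>"
proof -
  have "\<exists>N. \<forall>k<N. \<alpha> k v = 0" for v
  proof -
    obtain N where "\<And>n. n \<ge> N \<Longrightarrow> a n v = 0" using smooth[of v] by blast
    then show ?thesis by (intro exI[of _ "- N"]) (simp add: a_field_def)
  qed
  then show ?thesis by (simp add: is_field_def a_field_def linear_a)
qed

lemma is_field_beta: "is_field \<beta>"
proof -
  have "\<exists>N. \<forall>k<N. \<beta> k v = 0" for v
  proof -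
    obtain N where "\<And>n. n \<ge> N \<Longrightarrow> astar n v = 0" using smooth[of v] by blast
    then show ?thesis by (intro exI[of _ "- N"]) (simp add: astar_field_def)
  qed
  then show ?thesis by (simp add: is_field_def astar_field_def linear_astar)
qed

lemmas linear_alpha = is_field_linear[OF is_field_alpha]
lemmas linear_beta = is_field_linear[OF is_field_beta]

lemma alpha_alpha: "\<alpha> i (\<alpha> j v) = \<alpha> j (\<alpha> i v)"
  using a_a[of "- i - 1" "- j - 1" v] by (simp add: a_field_def)

lemma alpha_beta: "\<alpha> i (\<beta> j v) - \<beta> j (\<alpha> i v) = (if i + j = -1 then v else 0)"
proof -
  have "(- i - 1 + - j = 0) = (i + j = -1)" by auto
  then show ?thesis using a_astar[of "- i - 1" "- j" v] by (simp add: a_field_def astar_field_def)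
qed

lemma commuting_beta: "commuting \<beta> \<beta>"
  using astar_astar by (simp add: commuting_def astar_field_def)

lemma is_field_gamma: "is_field \<gamma>"
  by (rule is_field_mult[OF is_field_beta is_field_beta commuting_beta])

lemma commuting_beta_gamma: "commuting \<beta> \<gamma>"
  by (rule commuting_mult[OF is_field_beta is_field_beta is_field_beta
        commuting_beta commuting_beta commuting_beta])

definition normal_term :: "'v fdist \<Rightarrow> int \<Rightarrow> int \<Rightarrow> 'v \<Rightarrow> 'v" where
  "normal_term P k i v = (if 0 \<le> i then \<alpha> i (P (k - i) v) else P (k - i) (\<alpha> i v))"

lemma linear_normal_term: "is_field P \<Longrightarrow> linear_op (normal_term P k i)"
  unfolding normal_term_def[abs_def]
  using linear_op_intros(3)[OF linear_alpha is_field_linear]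
    linear_op_intros(3)[OF is_field_linear linear_alpha]
  by (cases "0 \<le> i") simp_all

lemma finite_normal_term:
  assumes "is_field P"
  shows "finite {i. normal_term P k i v \<noteq> 0}"
proof -
  obtain N where N: "\<And>i. i < N \<Longrightarrow> \<alpha> i v = 0" using is_field_bound[OF is_field_alpha] by blast
  obtain M where M: "\<And>i. i < M \<Longrightarrow> P i v = 0" using is_field_bound[OF assms] by blast
  have "normal_term P k i v = 0" if "i < min N 0 \<or> max 0 (k - M) < i" for i
    using that
    by (auto simp: normal_term_def N M is_field_zero_arg[OF assms] is_field_zero_arg[OF is_field_alpha])
  then have "{i. normal_term P k i v \<noteq> 0} \<subseteq> {min N 0..max 0 (k - M)}"
    by (force simp: not_less[symmetric])
  then show ?thesis by (rule finite_subset) simp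
qed

text \<open>
  The creation and the annihilation part combine into one sum over the index of \<open>\<alpha>\<close>, to which
  commutators can be applied termwise.
\<close>

lemma normal_product_eq:
  assumes "is_field P"
  shows "normal_product a P k v = Sum_any (\<lambda>i. normal_term P k i v)"
proof -
  let ?f = "\<lambda>i. if 0 \<le> i then normal_term P k i v else 0"
  let ?g = "\<lambda>i. if 0 \<le> i then 0 else normal_term P k i v"
  have "fd_mult (a_plus a) P k v = Sum_any ?f"
    unfolding fd_mult_def by (rule Sum_any.cong) (simp add: a_plus_def normal_term_def)
  moreover have "fd_mult P (a_minus a) k v = Sum_any ?g"
    unfolding fd_mult_def Sum_any_reflect[of "\<lambda>i. P i (a_minus a (k - i) v)" k, symmetric]
    by (rule Sum_any.cong)
      (simp add: a_minus_def normal_term_def is_field_zero_arg[OF assms])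
  moreover have "finite {i. ?f i \<noteq> 0}" "finite {i. ?g i \<noteq> 0}"
    by (rule finite_subset[OF _ finite_normal_term[OF assms, of k v]]; auto)+
  then have "Sum_any ?f + Sum_any ?g = Sum_any (\<lambda>i. ?f i + ?g i)"
    by (rule Sum_any.distrib[symmetric])
  moreover have "(\<lambda>i. ?f i + ?g i) = (\<lambda>i. normal_term P k i v)" by auto
  ultimately show ?thesis unfolding normal_product_def by (simp only:)
qed

lemma linear_normal_product:
  assumes "is_field P"
  shows "linear_op (normal_product a P k)"
proof -
  have "normal_product a P k = (\<lambda>v. Sum_any (\<lambda>i. normal_term P k i v))"
    by (rule ext) (rule normal_product_eq[OF assms])
  then show ?thesis
    using linear_op_Sum_any[of "normal_term P k", OF linear_normal_term[OF assms] finite_normal_term[OF assms]]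
    by (simp only:)
qed

lemma commutator_normal_product:
  assumes "linear_op D" "is_field P"
  shows "commutator D (normal_product a P k) v =
    Sum_any (\<lambda>i. commutator D (normal_term P k i) v)"
proof -
  have "normal_product a P k = (\<lambda>v. Sum_any (\<lambda>i. normal_term P k i v))"
    by (rule ext) (rule normal_product_eq[OF assms(2)])
  then show ?thesis
    using commutator_Sum_any[where T = "normal_term P k", OF assms(1) finite_normal_term[OF assms(2)]]
    by (simp only:)
qed

text \<open>
  The index of \<open>\<alpha>\<close>, and with it the ordering of each term, is unaffected, so there is no
  correction term.
\<close>

lemma commutator_alpha_normal_product:
  assumes "is_field P" "is_field Q"
    and "\<And>k v. commutator (\<alpha> m) (P k) v = Q (k + m + 1) v"
  shows "commutator (\<alpha> m) (normal_product a P k) v = normal_product a Q (k + m + 1) v"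
proof -
  have "commutator (\<alpha> m) (normal_term P k i) v = normal_term Q (k + m + 1) i v" for i
    using assms(3)[of "k - i" v] assms(3)[of "k - i" "\<alpha> i v"]
      linear_op_simps(4)[OF linear_alpha, of i "\<alpha> m (P (k - i) v)" "P (k - i) (\<alpha> m v)"]
    by (simp add: commutator_def normal_term_def alpha_alpha[of m i] algebra_simps)
  then show ?thesis
    by (simp add: commutator_normal_product[OF linear_alpha assms(1)] normal_product_eq[OF assms(2)])
qed

text \<open>
  Only the term in which \<open>\<alpha>\<close> is conjugate to \<open>\<beta> m\<close> contributes.
\<close>

lemma commutator_beta_normal_product:
  assumes P: "is_field P" and c: "commuting \<beta> P"
  shows "commutator (\<beta> m) (normal_product a P k) v = - P (k + m + 1) v"
proof -
  have "commutator (\<beta> m) (normal_term P k i) v = (if i = - m - 1 then - P (k + m + 1) v else 0)" for i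
  proof -
    have 1: "\<beta> m (P j v) = P j (\<beta> m v)" for j v using c by (simp add: commuting_def)
    show ?thesis
    proof (cases "i = - m - 1")
      case True
      then have "i + m = -1" by simp
      then have 2: "\<beta> m (\<alpha> i v) = \<alpha> i (\<beta> m v) - v" for v
        using alpha_beta[of i m v] by (simp add: algebra_simps)
      have 3: "k - i = k + m + 1" using True by simp
      have "commutator (\<beta> m) (normal_term P k i) v = - P (k + m + 1) v"
        by (simp add: commutator_def normal_term_def 1 2 3 linear_op_simps[OF is_field_linear[OF P]])
      then show ?thesis using True by simp
    next
      case False
      then have "\<beta> m (\<alpha> i v) = \<alpha> i (\<beta> m v)" for v
        using alpha_beta[of i m v] by (auto simp: algebra_simps)
      then show ?thesis using False by (simp add: commutator_def normal_term_def 1)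
    qed
  qed
  then show ?thesis
    by (simp add: commutator_normal_product[OF linear_beta P])
qed

abbreviation b :: "'v fdist" where "b \<equiv> normal_product a \<beta>"

lemmas linear_b = linear_normal_product[OF is_field_beta]

lemma normal_product_one: "normal_product a fd_one = \<alpha>"
proof (intro ext)
  fix k v
  have "normal_term fd_one k i v = (if i = k then \<alpha> k v else 0)" for i
    by (simp add: normal_term_def fd_one_def is_field_zero_arg[OF is_field_alpha])
  then show "normal_product a fd_one k v = \<alpha> k v"
    by (simp add: normal_product_eq[OF is_field_one])
qed

lemma commutator_alpha_beta: "commutator (\<alpha> m) (\<beta> k) v = fd_one (k + m + 1) v"
proof -
  have "(m + k = -1) = (k + m + 1 = 0)" by auto
  then show ?thesis by (simp add: commutator_def alpha_beta fd_one_def)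
qed

lemma commutator_alpha_gamma: "commutator (\<alpha> m) (\<gamma> k) v = scale 2 (\<beta> (k + m + 1) v)"
proof -
  have "commutator (\<alpha> m) (\<gamma> k) v =
      fd_mult fd_one \<beta> (k + (m + 1)) v + fd_mult \<beta> fd_one (k + (m + 1)) v"
    by (rule commutator_mult[OF linear_alpha is_field_beta is_field_beta is_field_one is_field_one])
      (simp_all add: commuting_beta commuting_one is_field_beta commuting_sym commutator_alpha_beta
        add.assoc)
  then show ?thesis
    using scale_left_distrib[of 1 1 "\<beta> (k + m + 1) v"]
    by (simp add: fd_mult_commute[of fd_one] commuting_sym commuting_one is_field_beta fd_mult_one_right
        add.assoc)
qed

lemma commutator_alpha_b: "commutator (\<alpha> m) (b k) v = \<alpha> (k + m + 1) v"
  using commutator_alpha_normal_product[OF is_field_beta is_field_one commutator_alpha_beta]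
  by (simp add: normal_product_one)

lemma commutator_beta_b: "commutator (\<beta> m) (b k) v = - \<beta> (k + m + 1) v"
  by (rule commutator_beta_normal_product[OF is_field_beta commuting_beta])

lemma commutator_beta_normal_gamma:
  "commutator (\<beta> m) (normal_product a \<gamma> k) v = - \<gamma> (k + m + 1) v"
  by (rule commutator_beta_normal_product[OF is_field_gamma commuting_beta_gamma])

lemma commutator_alpha_normal_gamma:
  "commutator (\<alpha> m) (normal_product a \<gamma> k) v = scale 2 (b (k + m + 1) v)"
proof -
  have f: "is_field (\<lambda>k v. scale 2 (\<beta> k v))"
    using is_field_beta by (fastforce simp: is_field_def intro: linear_op_intros_unary)
  have "normal_term (\<lambda>k v. scale 2 (\<beta> k v)) k i v = scale 2 (normal_term \<beta> k i v)" for k i v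
    by (simp add: normal_term_def linear_op_simps[OF linear_alpha])
  then have "normal_product a (\<lambda>k v. scale 2 (\<beta> k v)) k v = scale 2 (b k v)" for k
    using linear_op_apply_Sum_any[OF linear_op_trivial(2)[of 2] finite_normal_term[OF is_field_beta, of k v]]
    by (simp add: normal_product_eq[OF is_field_beta] normal_product_eq[OF f])
  then show ?thesis
    using commutator_alpha_normal_product[OF is_field_gamma f commutator_alpha_gamma] by simp
qed

text \<open>
  Termwise the commutator is a telescoping difference of normally ordered monomials, except for
  the indices where exactly one of \<open>i\<close> and \<open>i + m + 1\<close> is negative: there the shifted monomial comes out
  in the wrong order. Restoring the order costs \<open>\<plusminus>1\<close> each time, and there are \<open>\<bar>m + 1\<bar>\<close> such
  indices.
\<close>

lemma commutator_b_b: "commutator (b m) (b n) v = scale (if m + n = -2 then of_int (m + 1) else 0) v"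
proof -
  have 1: "b m (\<alpha> i v) = \<alpha> i (b m v) - \<alpha> (m + i + 1) v" for i v
    using commutator_alpha_b[of i m v] by (simp add: commutator_def algebra_simps)
  have 2: "b m (\<beta> i v) = \<beta> i (b m v) + \<beta> (m + i + 1) v" for i v
    using commutator_beta_b[of i m v] by (simp add: commutator_def algebra_simps)
  \<comment> \<open>the correction for normal ordering; it occurs only if the two factors are conjugate, that is, if \<open>m + n = -2\<close>\<close>
  define d where "d i = (if m + n = -2 then (if 0 \<le> i then 1 else 0) - (if 0 \<le> i + m + 1 then 1 else 0) else 0 :: complex)" for i
  have 3: "commutator (b m) (normal_term \<beta> n i) v =
      normal_term \<beta> (m + n + 1) i v - normal_term \<beta> (m + n + 1) (i + (m + 1)) v - scale (d i) v" for i
  proof -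
    have "commutator (b m) (normal_term \<beta> n i) v = normal_term \<beta> (m + n + 1) i v -
       (if 0 \<le> i then \<alpha> (m + i + 1) (\<beta> (n - i) v) else \<beta> (n - i) (\<alpha> (m + i + 1) v))"
      by (simp add: commutator_def normal_term_def 1 2 linear_op_simps[OF linear_alpha]
          linear_op_simps[OF linear_beta] algebra_simps)
    moreover have "\<alpha> (m + i + 1) (\<beta> (n - i) v) =
        \<beta> (n - i) (\<alpha> (m + i + 1) v) + (if m + n = -2 then v else 0)"
      using alpha_beta[of "m + i + 1" "n - i" v] by (auto simp: algebra_simps)
    ultimately show ?thesis
      by (auto simp: normal_term_def d_def algebra_simps)
  qed
  let ?N = "\<lambda>i. normal_term \<beta> (m + n + 1) i v"
  have fN: "finite {i. ?N i \<noteq> 0}" by (rule finite_normal_term[OF is_field_beta])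
  have fN': "finite {i. ?N (i + (m + 1)) \<noteq> 0}"
    using finite_vimageI[OF fN inj_on_add', of "m + 1"] by (simp only: vimage_def mem_Collect_eq)
  have fNN: "finite {i. ?N i - ?N (i + (m + 1)) \<noteq> 0}"
    by (rule finite_subset[OF _ finite_UnI[OF fN fN']]) auto
  have d0: "d i = 0" if "i \<notin> {0..< - m - 1} \<union> {- m - 1..<0}" for i
    using that by (auto simp: d_def)
  have fd: "finite {i. d i \<noteq> 0}"
    by (rule finite_subset[of _ "{0..< - m - 1} \<union> {- m - 1..<0}"]) (use d0 in blast, simp)
  have fdv: "finite {i. scale (d i) v \<noteq> 0}" by (rule finite_subset[OF _ fd]) auto
  have "Sum_any d = (\<Sum>i\<in>{0..< - m - 1} \<union> {- m - 1..<0}. d i)"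
    by (rule Sum_any.expand_superset) (simp, use d0 in blast)
  also have "\<dots> = (\<Sum>i\<in>{0..< - m - 1}. d i) + (\<Sum>i\<in>{- m - 1..<0}. d i)"
    by (rule sum.union_disjoint) auto
  also have "(\<Sum>i\<in>{0..< - m - 1}. d i) = (\<Sum>i\<in>{0..< - m - 1}. if m + n = -2 then 1 else 0)"
    by (rule sum.cong) (auto simp: d_def)
  also have "(\<Sum>i\<in>{- m - 1..<0}. d i) = (\<Sum>i\<in>{- m - 1..<0}. if m + n = -2 then -1 else 0)"
    by (rule sum.cong) (auto simp: d_def)
  finally have sd: "Sum_any d = (if m + n = -2 then - of_int (m + 1) else 0)"
    by (cases "m + 1 \<ge> 0") (simp_all add: of_nat_nat)
  have sdv: "Sum_any (\<lambda>i. scale (d i) v) = scale (Sum_any d) v"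
  proof -
    have "Sum_any (\<lambda>i. scale (d i) v) = (\<Sum>i\<in>{i. d i \<noteq> 0}. scale (d i) v)"
      by (rule Sum_any.expand_superset[OF fd]) auto
    then show ?thesis by (simp add: Sum_any.expand_set scale_sum_left)
  qed
  have "commutator (b m) (b n) v = Sum_any (\<lambda>i. ?N i - ?N (i + (m + 1)) - scale (d i) v)"
    unfolding commutator_normal_product[OF linear_b is_field_beta] 3 ..
  also have "\<dots> = Sum_any ?N - Sum_any ?N - scale (Sum_any d) v"
    unfolding Sum_any_diff[OF fNN fdv] Sum_any_diff[OF fN fN'] Sum_any_shift[of ?N] sdv ..
  finally show ?thesis
    unfolding sd by (simp add: scale_left_distrib scale_left_diff_distrib)
qed

lemma commutator_mult_scalar:
  assumes "linear_op D" "is_field P" "is_field P'"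
    and "\<And>k v. commutator D (P k) v = P' (k + s) v"
  shows "commutator D (fd_mult P (fd_scalar scale chi) k) v = fd_mult P' (fd_scalar scale chi) (k + s) v"
proof -
  have "commutator D (fd_scalar scale chi k) v = 0" for k v
    using commutator_right(5)[OF assms(1)] by (simp add: fd_scalar_def[abs_def])
  then show ?thesis
    using commutator_mult[OF assms(1,2) is_field_scalar assms(3) is_field_zero
        commuting_scalar[OF assms(2)] commuting_scalar[OF assms(3)] commuting_zero[OF assms(2)]
        assms(4), of chi k v]
    by (simp add: fd_mult_zero_right[OF assms(2)])
qed

text \<open>
  The operator \<open>b (-1)\<close> is \<open>b(0)\<close>, which grades the Weyl algebra by charge. An operator commuting
  with the Weyl algebra commutes with \<open>b(0)\<close>, so it cannot have a nonzero charge.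
\<close>

lemma weight_nonzero_imp_zero:
  assumes C: "linear_op C"
    and "\<And>k v. commutator (\<alpha> k) C v = 0" "\<And>k v. commutator (\<beta> k) C v = 0"
    and "commutator (b (-1)) C v = scale c (C v)" "c \<noteq> 0"
  shows "C v = 0"
proof -
  have "C (\<alpha> k v) = \<alpha> k (C v)" "C (\<beta> k v) = \<beta> k (C v)" for k v
    using assms(2)[of k v] assms(3)[of k v] by (simp_all add: commutator_def)
  then have "commutator C (normal_term \<beta> k i) v = 0" for k i
    by (simp add: commutator_def normal_term_def)
  then have "commutator C (b (-1)) v = 0"
    by (simp add: commutator_normal_product[OF C is_field_beta])
  then show ?thesis using assms(4,5) commutator_skew[of "b (-1)" C v] by simp
qed

section \<open>The Wakimoto currents\<close>

definition wak_h :: "complex fls \<Rightarrow> 'v fdist" where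
  "wak_h chi k v = scale (-2) (b k v) + fd_scalar scale chi k v"

definition wak_f :: "complex fls \<Rightarrow> 'v fdist" where
  "wak_f chi k v = - normal_product a \<gamma> k v - scale 2 (fd_deriv scale \<beta> k v)
    + fd_mult \<beta> (fd_scalar scale chi) k v"

lemma linear_wak_h: "linear_op (wak_h chi k)"
  unfolding wak_h_def[abs_def]
  by (rule linear_op_intros(1)[OF linear_op_intros_unary(1)[OF linear_b] is_field_linear[OF is_field_scalar]])

lemma linear_wak_f: "linear_op (wak_f chi k)"
  unfolding wak_f_def[abs_def] fd_deriv_def
  by (rule linear_op_intros(1)[OF linear_op_intros(2)[OF
          linear_op_intros_unary(2)[OF linear_normal_product[OF is_field_gamma]]
          linear_op_intros_unary(1)[OF linear_op_intros_unary(1)[OF linear_beta]]]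
        is_field_linear[OF is_field_mult[OF is_field_beta is_field_scalar commuting_scalar[OF is_field_beta]]]])

lemma commutator_wak_h:
  assumes "linear_op D"
  shows "commutator D (wak_h chi k) v = scale (-2) (commutator D (b k) v)"
  unfolding wak_h_def[abs_def] fd_scalar_def
  by (simp add: commutator_right[OF assms])

lemma commutator_wak_f:
  assumes "linear_op D" "is_field P" "\<And>k v. commutator D (\<beta> k) v = P (k + s) v"
  shows "commutator D (wak_f chi k) v = - commutator D (normal_product a \<gamma> k) v
    - scale (2 * of_int (k + 1)) (P (k + s + 1) v) + fd_mult P (fd_scalar scale chi) (k + s) v"
  unfolding wak_f_def[abs_def] fd_deriv_def
  by (simp add: commutator_right[OF assms(1)] assms(3) commutator_mult_scalar[OF assms(1) is_field_beta assms(2,3)]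
      ac_simps)

lemma alpha_wak_h: "commutator (\<alpha> m) (wak_h chi k) = (\<lambda>v. scale (-2) (\<alpha> (k + m + 1) v))"
  by (rule ext) (simp add: commutator_wak_h[OF linear_alpha] commutator_alpha_b)

lemma beta_wak_h: "commutator (\<beta> m) (wak_h chi k) = (\<lambda>v. scale 2 (\<beta> (k + m + 1) v))"
  by (rule ext) (simp add: commutator_wak_h[OF linear_beta] commutator_beta_b)

lemma b_wak_h: "commutator (b m) (wak_h chi k) v =
    scale (if m + k = -2 then -2 * of_int (m + 1) else 0) v"
  by (simp add: commutator_wak_h[OF linear_b] commutator_b_b scale_left_distrib scale_left_diff_distrib)

lemma wak_h_wak_h: "commutator (wak_h chi m) (wak_h chi k) v =
    scale (if m + k = -2 then 4 * of_int (m + 1) else 0) v"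
  by (subst wak_h_def[abs_def])
    (simp add: commutator_left[OF linear_wak_h] b_wak_h fd_scalar_def[abs_def]
      scale_left_distrib scale_left_diff_distrib)

text \<open>
  The central term comes from the derivative of \<open>a\<^sup>*(z)\<close> alone; its coefficient \<open>-2\<close> in \<open>f(z)\<close> is
  the level.
\<close>

lemma alpha_wak_f: "commutator (\<alpha> m) (wak_f chi k) =
    (\<lambda>v. wak_h chi (k + m + 1) v + scale (if m + k = -2 then 2 * of_int (m + 1) else 0) v)"
proof
  fix v
  have c: "commutator (\<alpha> m) (\<beta> k) v = fd_one (k + (m + 1)) v" for k v
    using commutator_alpha_beta[of m k v] by (simp add: add.assoc)
  have "fd_mult fd_one (fd_scalar scale chi) j v = fd_scalar scale chi j v" for j
    by (simp add: fd_mult_commute[of fd_one] commuting_scalar is_field_one fd_mult_one_right is_field_scalar)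
  moreover have "scale (2 * of_int (k + 1)) (fd_one (k + (m + 1) + 1) v) =
      - scale (if m + k = -2 then 2 * of_int (m + 1) else 0) v"
  proof (cases "m + k = -2")
    case True
    then have k: "k + (m + 1) + 1 = 0" and "k + 1 = - (m + 1)" by auto
    then have "(of_int (k + 1) :: complex) = - of_int (m + 1)" by (simp only: of_int_minus)
    then show ?thesis using True by (simp add: fd_one_def k del: of_int_add)
  qed (simp add: fd_one_def)
  ultimately show "commutator (\<alpha> m) (wak_f chi k) v =
      wak_h chi (k + m + 1) v + scale (if m + k = -2 then 2 * of_int (m + 1) else 0) v"
    by (simp add: commutator_wak_f[OF linear_alpha is_field_one c] commutator_alpha_normal_gamma
        wak_h_def add.assoc)
qed

lemma beta_wak_f: "commutator (\<beta> m) (wak_f chi k) = \<gamma> (k + m + 1)"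
proof
  fix v
  have c: "commutator (\<beta> m) (\<beta> k) v = 0" for k v
    using commuting_beta by (simp add: commutator_def commuting_def)
  show "commutator (\<beta> m) (wak_f chi k) v = \<gamma> (k + m + 1) v"
    by (simp add: commutator_wak_f[of "\<beta> m" "\<lambda>k v. 0" 0, OF linear_beta is_field_zero c] commutator_beta_normal_gamma
        fd_mult_def[of "\<lambda>k v. 0"])
qed

lemma commutator_b_beta: "commutator (b m) (\<beta> k) v = \<beta> (k + (m + 1)) v"
  using commutator_skew[of "b m" "\<beta> k" v] by (simp add: commutator_beta_b ac_simps)

lemma commutator_b_gamma: "commutator (b m) (\<gamma> k) v = scale 2 (\<gamma> (k + (m + 1)) v)"
  using commutator_mult[OF linear_b is_field_beta is_field_beta is_field_beta is_field_beta
      commuting_beta commuting_beta commuting_beta commutator_b_beta commutator_b_beta, of m k]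
    scale_left_distrib[of 1 1 "\<gamma> (k + (m + 1)) v"]
  by simp

text \<open>
  Charge 2 for \<open>\<gamma>\<close> and \<open>-1\<close> for \<open>\<alpha>\<close>.
\<close>

lemma b_zero_normal_gamma:
  "commutator (b (-1)) (normal_product a \<gamma> k) v = normal_product a \<gamma> k v"
proof -
  have 1: "b (-1) (\<alpha> i v) = \<alpha> i (b (-1) v) - \<alpha> i v" for i v
    using commutator_alpha_b[of i "-1" v] by (simp add: commutator_def algebra_simps)
  have 2: "b (-1) (\<gamma> i v) = \<gamma> i (b (-1) v) + (\<gamma> i v + \<gamma> i v)" for i v
    using commutator_b_gamma[of "-1" i v] scale_left_distrib[of 1 1 "\<gamma> i v"]
    by (simp add: commutator_def algebra_simps)
  have "commutator (b (-1)) (normal_term \<gamma> k i) v = normal_term \<gamma> k i v" for i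
    by (simp add: commutator_def normal_term_def 1 2 linear_op_simps[OF linear_alpha]
        linear_op_simps[OF is_field_linear[OF is_field_gamma]])
  then show ?thesis
    by (simp add: commutator_normal_product[OF linear_b is_field_gamma] normal_product_eq[OF is_field_gamma])
qed

lemma b_zero_wak_f: "commutator (b (-1)) (wak_f chi k) v = wak_f chi k v"
proof -
  have c: "commutator (b (-1)) (\<beta> k) v = \<beta> (k + 0) v" for k v
    using commutator_b_beta[of "-1"] by simp
  show ?thesis
    by (simp add: commutator_wak_f[of _ \<beta> 0, OF linear_b is_field_beta c] b_zero_normal_gamma wak_f_def fd_deriv_def)
qed

text \<open>
  What matters is that the right-hand side depends only on \<open>k + m\<close>: this makes \<open>[\<beta>, [f, f]]\<close>
  vanish.
\<close>

lemma wak_f_gamma: "commutator (wak_f chi m) (\<gamma> k) v =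
    - fd_mult \<gamma> \<beta> (k + (m + 1)) v - fd_mult \<beta> \<gamma> (k + (m + 1)) v"
proof -
  have c: "commutator (wak_f chi m) (\<beta> k) v = - \<gamma> (k + (m + 1)) v" for k v
    using commutator_skew[of "wak_f chi m" "\<beta> k" v] by (simp add: beta_wak_f ac_simps)
  have n: "commuting (\<lambda>k v. - \<gamma> k v) \<beta>" "commuting \<beta> (\<lambda>k v. - \<gamma> k v)"
    using commuting_beta_gamma by (simp_all add: commuting_def linear_op_simps[OF linear_beta])
  have neg: "Sum_any (\<lambda>i. - f i) = - Sum_any f" for f :: "int \<Rightarrow> 'v"
    by (simp add: Sum_any.expand_set sum_negf)
  show ?thesis
    using commutator_mult[of "wak_f chi m" \<beta> \<beta> "\<lambda>k v. - \<gamma> k v" "\<lambda>k v. - \<gamma> k v" "m + 1" k v,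
        OF linear_wak_f is_field_beta is_field_beta is_field_minus[OF is_field_gamma]
        is_field_minus[OF is_field_gamma] commuting_beta n c c]
    by (simp add: fd_mult_def[of _ \<gamma>] fd_mult_def[of \<gamma>] fd_mult_def[of "\<lambda>k v. - \<gamma> k v"]
        fd_mult_def[of _ "\<lambda>k v. - \<gamma> k v"] linear_op_simps[OF linear_beta] neg)
qed

text \<open>
  The defect \<open>C\<close> commutes with \<open>\<alpha>\<close> because the central terms of \<open>[h, h]\<close> and \<open>[e, f]\<close> match, and with
  \<open>\<beta>\<close> because \<open>\<gamma>\<close> has twice the \<open>h\<close>-weight of \<open>\<beta>\<close>. Its charge is that of \<open>f\<close>, namely 1.
\<close>

lemma wak_h_wak_f: "commutator (wak_h chi m) (wak_f chi n) v = scale (-2) (wak_f chi (m + n + 1) v)"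
proof -
  let ?H = "wak_h chi" and ?F = "wak_f chi"
  define C where "C v = commutator (?H m) (?F n) v + scale 2 (?F (m + n + 1) v)" for v
  have C: "linear_op C"
    unfolding C_def[abs_def]
    by (rule linear_op_intros(1)[OF linear_op_intros(4)[OF linear_wak_h linear_wak_f]
        linear_op_intros_unary(1)[OF linear_wak_f]])
  have D: "commutator D C v = commutator (commutator D (?H m)) (?F n) v
      + commutator (?H m) (commutator D (?F n)) v + scale 2 (commutator D (?F (m + n + 1)) v)"
    if "linear_op D" for D v
    unfolding C_def[abs_def] commutator_right[OF that]
      commutator_jacobi[OF that linear_wak_h linear_wak_f] ..
  have ca: "commutator (\<alpha> k) C v = 0" for k v
  proof -
    have i: "(m + k + 1 + n = -2) = (m + n + k = -3)" "(m + (n + k + 1) = -2) = (m + n + k = -3)"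
      "(k + (m + n + 1) = -2) = (m + n + k = -3)" "n + (m + k + 1) + 1 = m + n + 1 + k + 1"
      by auto
    show ?thesis
      unfolding D[OF linear_alpha] alpha_wak_h alpha_wak_f commutator_left[OF linear_wak_f]
        commutator_right[OF linear_wak_h] wak_h_wak_h i
      using scale_left_distrib[of 4 4 v]
      by (cases "m + n + k = -3")
        (simp_all add: scale_right_distrib scale_left_distrib scale_left_diff_distrib)
  qed
  have cb: "commutator (\<beta> k) C v = 0" for k v
  proof -
    have H: "commutator (?H m) (\<gamma> j) v = scale (-4) (\<gamma> (j + (m + 1)) v)" for j
      using commutator_skew[of "?H m" "\<gamma> j" v] commutator_skew[of "\<gamma> j" "b m" v]
      by (simp add: commutator_wak_h[OF is_field_linear[OF is_field_gamma]] commutator_b_gamma)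
    have i: "n + (m + k + 1) + 1 = m + n + 1 + k + 1" "n + k + 1 + (m + 1) = m + n + 1 + k + 1"
      by auto
    show ?thesis
      unfolding D[OF linear_beta] beta_wak_h beta_wak_f commutator_left[OF linear_wak_f] H i
        scale_left_distrib[symmetric]
      by simp
  qed
  have cw: "commutator (b (-1)) C v = scale 1 (C v)"
  proof -
    have 1: "commutator (b (-1)) (?H m) = (\<lambda>v. 0)" "commutator (b (-1)) (?F n) = ?F n"
      by (rule ext, simp add: b_wak_h b_zero_wak_f)+
    show ?thesis
      unfolding D[OF linear_b] 1 commutator_left(7)[OF linear_wak_f] b_zero_wak_f C_def by simp
  qed
  have "C v = 0" by (rule weight_nonzero_imp_zero[OF C ca cb cw]) simp
  then show ?thesis by (simp add: C_def eq_neg_iff_add_eq_0)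
qed

text \<open>
  The same argument as for \<open>[h, f]\<close>, now with charge 2.
\<close>

lemma wak_f_wak_f: "commutator (wak_f chi m) (wak_f chi n) v = 0"
proof -
  let ?H = "wak_h chi" and ?F = "wak_f chi"
  have C: "linear_op (commutator (?F m) (?F n))"
    by (rule linear_op_intros(4)[OF linear_wak_f linear_wak_f])
  have FH: "commutator (?F p) (?H q) v = scale 2 (?F (p + q + 1) v)" for p q v
    using commutator_skew[of "?F p" "?H q" v] by (simp add: wak_h_wak_f ac_simps)
  have gF: "commutator (\<gamma> p) (?F q) v = - commutator (?F q) (\<gamma> p) v" for p q v
    by (rule commutator_skew)
  have ca: "commutator (\<alpha> k) (commutator (?F m) (?F n)) v = 0" for k v
    unfolding commutator_jacobi[OF linear_alpha linear_wak_f linear_wak_f] alpha_wak_f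
      commutator_left[OF linear_wak_f] commutator_right[OF linear_wak_f] wak_h_wak_f FH
    by (simp add: ac_simps scale_left_distrib[symmetric])
  have cb: "commutator (\<beta> k) (commutator (?F m) (?F n)) v = 0" for k v
    unfolding commutator_jacobi[OF linear_beta linear_wak_f linear_wak_f] beta_wak_f gF wak_f_gamma
    by (simp add: ac_simps)
  have cw: "commutator (b (-1)) (commutator (?F m) (?F n)) v = scale 2 (commutator (?F m) (?F n) v)"
  proof -
    have 1: "commutator (b (-1)) (?F k) = ?F k" for k by (rule ext) (rule b_zero_wak_f)
    show ?thesis
      unfolding commutator_jacobi[OF linear_b linear_wak_f linear_wak_f] 1
      using scale_left_distrib[of 1 1 "commutator (?F m) (?F n) v"] by simp
  qed
  show ?thesis by (rule weight_nonzero_imp_zero[OF C ca cb cw]) simp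
qed

section \<open>Recovering the Weyl algebra from the currents\<close>

text \<open>
  The index \<open>i = -1\<close> belongs to \<open>a(0)\<close>, and \<open>i < 0\<close> to \<open>a(n)\<close> with \<open>n \<ge> 0\<close>.
\<close>

definition alpha_shifted :: "complex \<Rightarrow> 'v fdist" where
  "alpha_shifted lam i v = \<alpha> i v - scale (if i = -1 then lam else 0) v"

text \<open>
  The vectors killed by every product of \<open>r\<close> of the operators \<open>a(n) - \<lambda>\<delta>\<^bsub>n,0\<^esub>\<close> with \<open>n \<ge> 0\<close>.
\<close>

primrec nilpotent_part :: "complex \<Rightarrow> nat \<Rightarrow> 'v set" where
  "nilpotent_part lam 0 = {0}"
| "nilpotent_part lam (Suc r) = {v. \<forall>i<0. alpha_shifted lam i v \<in> nilpotent_part lam r}"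

lemma linear_alpha_shifted: "linear_op (alpha_shifted lam i)"
  unfolding alpha_shifted_def[abs_def]
  by (rule linear_op_intros(2)[OF linear_alpha linear_op_trivial(2)])

lemma subspace_nilpotent_part: "subspace (nilpotent_part lam r)"
proof (induction r)
  case 0
  show ?case by (simp add: subspace_def)
next
  case (Suc r)
  then show ?case
    by (simp add: subspace_def linear_op_simps[OF linear_alpha_shifted])
qed

lemma nilpotent_part_mono: "r \<le> s \<Longrightarrow> nilpotent_part lam r \<subseteq> nilpotent_part lam s"
proof (rule lift_Suc_mono_le)
  show "nilpotent_part lam r \<subseteq> nilpotent_part lam (Suc r)" for r
    by (induction r) (auto simp: linear_op_simps[OF linear_alpha_shifted])
qed

lemma alpha_nilpotent_part: "v \<in> nilpotent_part lam r \<Longrightarrow> \<alpha> j v \<in> nilpotent_part lam r"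
proof (induction r arbitrary: v)
  case 0
  then show ?case by (simp add: linear_op_simps[OF linear_alpha])
next
  case (Suc r)
  have "alpha_shifted lam i (\<alpha> j v) = \<alpha> j (alpha_shifted lam i v)" for i
    by (simp add: alpha_shifted_def linear_op_simps[OF linear_alpha] alpha_alpha[of i j])
  then show ?case using Suc by simp
qed

text \<open>
  Moving \<open>\<beta>\<close> to the left through the operators \<open>alpha_shifted\<close> uses up at most one of them.
\<close>

lemma beta_nilpotent_part: "v \<in> nilpotent_part lam r \<Longrightarrow> \<beta> j v \<in> nilpotent_part lam (Suc r)"
proof (induction r arbitrary: v)
  case 0
  then show ?case
    by (simp add: linear_op_simps[OF linear_beta] linear_op_simps[OF linear_alpha_shifted])
next
  case (Suc r)
  have "alpha_shifted lam i (\<beta> j v) \<in> nilpotent_part lam (Suc r)" if "i < 0" for i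
  proof -
    have "alpha_shifted lam i (\<beta> j v) = \<beta> j (alpha_shifted lam i v) + scale (if i + j = -1 then 1 else 0) v"
      using alpha_beta[of i j v]
      by (auto simp: alpha_shifted_def linear_op_simps[OF linear_beta] algebra_simps)
    moreover have "\<beta> j (alpha_shifted lam i v) \<in> nilpotent_part lam (Suc r)"
      using Suc that by simp
    ultimately show ?thesis
      using Suc.prems subspace_add[OF subspace_nilpotent_part] subspace_scale[OF subspace_nilpotent_part]
      by metis
  qed
  then show ?case by simp
qed

text \<open>
  This is where \<open>\<lambda> \<noteq> 0\<close> enters. In the coefficient of \<open>b\<close> at \<open>k - 1\<close>, the term with \<open>\<alpha> (-1)\<close> is
  \<open>\<lambda> \<beta> k w\<close> up to \<open>\<beta> k\<close> applied to a vector of smaller nilpotency. The terms to its left in the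
  index, \<open>i < -1\<close>, contain only vectors of smaller nilpotency as well, and the terms with \<open>i \<ge> 0\<close>
  contain \<open>\<beta> j w\<close> only for \<open>j < k\<close>. So \<open>\<beta> k w\<close> is recovered by induction, first on \<open>r\<close>, then on
  \<open>k\<close>, starting below the lowest power of \<open>z\<close> in \<open>\<beta>(z) w\<close>.
\<close>

lemma beta_stable_if_alpha_b_stable:
  assumes W: "subspace W"
    and Wa: "\<And>k w. w \<in> W \<Longrightarrow> \<alpha> k w \<in> W" and Wb: "\<And>k w. w \<in> W \<Longrightarrow> b k w \<in> W"
    and lam: "lam \<noteq> 0"
    and "w \<in> W" "w \<in> nilpotent_part lam r"
  shows "\<beta> k w \<in> W"
  using assms(5,6)
proof (induction r arbitrary: w k)
  case 0
  then show ?case by (simp add: linear_op_simps[OF linear_beta])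
next
  case (Suc r)
  obtain N where N: "\<And>k. k < N \<Longrightarrow> \<beta> k w = 0" using is_field_bound[OF is_field_beta] by blast
  have step: "\<beta> k w \<in> W" if low: "\<And>j. j < k \<Longrightarrow> \<beta> j w \<in> W" for k
  proof -
    have sh: "alpha_shifted lam i w \<in> W \<and> alpha_shifted lam i w \<in> nilpotent_part lam r" if "i < 0" for i
      using Suc.prems that Wa subspace_diff[OF W] subspace_scale[OF W]
      by (simp add: alpha_shifted_def)
    let ?T = "\<lambda>i. normal_term \<beta> (k - 1) i w"
    have T: "?T i \<in> W" if "i \<noteq> -1" for i
    proof (cases "0 \<le> i")
      case True
      then show ?thesis using Wa low by (simp add: normal_term_def)
    next
      case False
      then show ?thesis using that sh[of i] Suc.IH by (simp add: normal_term_def alpha_shifted_def)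
    qed
    have fin: "finite {i. ?T i \<noteq> 0}" by (rule finite_normal_term[OF is_field_beta])
    have "b (k - 1) w = sum ?T (insert (-1) {i. ?T i \<noteq> 0})"
      unfolding normal_product_eq[OF is_field_beta]
      by (rule Sum_any.expand_superset) (use fin in auto)
    also have "\<dots> = ?T (-1) + sum ?T ({i. ?T i \<noteq> 0} - {-1})"
      by (rule sum.insert_remove[OF fin])
    finally have "?T (-1) = b (k - 1) w - sum ?T ({i. ?T i \<noteq> 0} - {-1})" by simp
    moreover have "?T (-1) = scale lam (\<beta> k w) + \<beta> k (alpha_shifted lam (-1) w)"
      by (simp add: normal_term_def alpha_shifted_def linear_op_simps[OF linear_beta])
    ultimately have "scale lam (\<beta> k w) = b (k - 1) w - sum ?T ({i. ?T i \<noteq> 0} - {-1})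
        - \<beta> k (alpha_shifted lam (-1) w)"
      by (simp only: eq_diff_eq)
    moreover have "sum ?T ({i. ?T i \<noteq> 0} - {-1}) \<in> W"
      using T by (intro subspace_sum[OF W]) auto
    moreover have "\<beta> k (alpha_shifted lam (-1) w) \<in> W"
      using sh[of "-1"] by (intro Suc.IH) simp_all
    ultimately have "scale lam (\<beta> k w) \<in> W"
      using subspace_diff[OF W subspace_diff[OF W Wb[OF Suc.prems(1)]]] by (simp only:)
    from subspace_scale[OF W this, of "1 / lam"] show ?thesis using lam by simp
  qed
  have "\<forall>j<k. \<beta> j w \<in> W" if "N \<le> k" for k
    using that
  proof (induction k rule: int_ge_induct)
    case base
    then show ?case using N subspace_0[OF W] by simp
  next
    case (step k)
    have "j < k \<or> j = k" if "j < k + 1" for j using that by auto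
    then show ?case using step.IH \<open>\<And>k. (\<And>j. j < k \<Longrightarrow> \<beta> j w \<in> W) \<Longrightarrow> \<beta> k w \<in> W\<close> by blast
  qed
  from this[of "max N (k + 1)"] show ?case by simp
qed

end

sublocale M1 \<subseteq> smooth_weyl_module scale a astar
  by unfold_locales (rule M1_smooth)

context M1
begin

text \<open>
  The union of the filtration is a Weyl submodule, and \<open>v\<^sub>1\<close> lies in its first step.
\<close>

lemma ex_nilpotent_part: "\<exists>r. v \<in> nilpotent_part lam r"
proof -
  define W where "W = (\<Union>r. nilpotent_part lam r)"
  have W: "w \<in> W \<longleftrightarrow> (\<exists>r. w \<in> nilpotent_part lam r)" for w by (simp add: W_def)
  have "subspace W"
  proof (rule subspaceI)
    show "0 \<in> W" unfolding W by (rule exI[of _ 0]) simp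
  next
    fix x y assume "x \<in> W" "y \<in> W"
    then obtain r s where "x \<in> nilpotent_part lam r" "y \<in> nilpotent_part lam s"
      unfolding W by blast
    then have "x \<in> nilpotent_part lam (max r s)" "y \<in> nilpotent_part lam (max r s)"
      using nilpotent_part_mono[of r "max r s" lam] nilpotent_part_mono[of s "max r s" lam] by auto
    then show "x + y \<in> W" unfolding W using subspace_add[OF subspace_nilpotent_part] by blast
  next
    fix c x assume "x \<in> W"
    then show "scale c x \<in> W" unfolding W using subspace_scale[OF subspace_nilpotent_part] by blast
  qed
  moreover have "a n w \<in> W \<and> astar n w \<in> W" if "w \<in> W" for n w
  proof -
    have "a n w = \<alpha> (- n - 1) w" "astar n w = \<beta> (- n) w"
      by (simp_all add: a_field_def astar_field_def)
    then show ?thesis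
      using that alpha_nilpotent_part beta_nilpotent_part unfolding W by metis
  qed
  ultimately have "invariant_subspace scale (range a \<union> range astar) W"
    unfolding invariant_subspace_def by blast
  moreover have "v\<^sub>1 \<in> W"
    unfolding W
  proof (rule exI[of _ 1])
    have "alpha_shifted lam i v\<^sub>1 = 0" if "i < 0" for i
    proof (cases "i = -1")
      case True
      then show ?thesis using a_0 by (simp add: alpha_shifted_def a_field_def)
    next
      case False
      define n where "n = - i - 1"
      have "1 \<le> n" using that False by (simp add: n_def)
      then have "a n v\<^sub>1 = 0" using a_pos[of "n - 1"] by simp
      then show ?thesis using False by (simp add: alpha_shifted_def a_field_def n_def)
    qed
    then show "v\<^sub>1 \<in> nilpotent_part lam 1" by simp
  qed
  ultimately have "W = UNIV" by (rule generated)
  then show ?thesis using W by blast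
qed

text \<open>
  Subspaces stable under \<open>\<alpha>\<close> and \<open>b\<close> are Weyl submodules.
\<close>

lemma simple_under_alpha_b:
  assumes "lam \<noteq> 0" and "\<And>k. \<alpha> k \<in> T"
    and b: "\<And>W k w. invariant_subspace scale T W \<Longrightarrow> w \<in> W \<Longrightarrow> b k w \<in> W"
  shows "simple_under scale T"
  unfolding simple_under_def
proof (intro conjI allI impI)
  show "UNIV \<noteq> {0 :: 'v}" using simple by (simp add: simple_under_def)
next
  fix W assume W: "invariant_subspace scale T W"
  have "\<beta> k w \<in> W" if "w \<in> W" for k w
    using ex_nilpotent_part[of w] beta_stable_if_alpha_b_stable[of W lam w _ k] assms(1,2) b[OF W] W that
    by (auto simp: invariant_subspace_def)
  from this[of _ "- n" for n] have "astar n w \<in> W" if "w \<in> W" for n w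
    using that by (simp add: astar_field_def)
  moreover have "a n w \<in> W" if "w \<in> W" for n w
    using assms(2)[of "- n - 1"] W that by (auto simp: invariant_subspace_def a_field_def)
  ultimately have "invariant_subspace scale (range a \<union> range astar) W"
    using W by (auto simp: invariant_subspace_def)
  then show "W = {0} \<or> W = UNIV" using simple by (simp add: simple_under_def)
qed

end

section \<open>Modules from currents\<close>

text \<open>
  Here \<open>e n\<close>, \<open>h n\<close>, \<open>f n\<close> are modes, so these are the relations of the affine algebra on its
  standard spanning set, and bilinearity extends them to all of it.
\<close>

locale affine_sl2_currents = complex_vector_space scale
  for scale :: "complex \<Rightarrow> 'v::ab_group_add \<Rightarrow> 'v" +
  fixes e h f :: "int \<Rightarrow> 'v \<Rightarrow> 'v" and kappa :: complex
  assumes linear_e: "linear_op (e n)" and linear_h: "linear_op (h n)" and linear_f: "linear_op (f n)"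
    and e_e: "commutator (e m) (e n) v = 0"
    and f_f: "commutator (f m) (f n) v = 0"
    and h_h: "commutator (h m) (h n) v = scale (if m + n = 0 then 2 * of_int m * kappa else 0) v"
    and h_e: "commutator (h m) (e n) v = scale 2 (e (m + n) v)"
    and h_f: "commutator (h m) (f n) v = scale (-2) (f (m + n) v)"
    and e_f: "commutator (e m) (f n) v =
      h (m + n) v + scale (if m + n = 0 then of_int m * kappa else 0) v"
begin

definition mode :: "sl2 \<Rightarrow> int \<Rightarrow> 'v \<Rightarrow> 'v" where
  "mode x n v = scale (fst x) (e n v) + scale (fst (snd x)) (h n v) + scale (snd (snd x)) (f n v)"

lemma linear_mode: "linear_op (mode x n)"
  unfolding mode_def[abs_def]
  by (rule linear_op_intros(1)[OF linear_op_intros(1)] linear_op_intros_unary(1)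
      linear_e linear_h linear_f)+

lemma mode_zero: "mode 0 n v = 0"
  by (simp add: mode_def)

lemma mode_add: "mode (x + y) n v = mode x n v + mode y n v"
  by (simp add: mode_def scale_left_distrib)

lemma mode_scale: "mode (sl2_scale s x) n v = scale s (mode x n v)"
  by (cases x) (simp add: mode_def scale_right_distrib)

lemma mode_bracket: "commutator (mode x m) (mode y n) v = mode (sl2_bracket x y) (m + n) v
    + scale (kappa * (if m + n = 0 then of_int m * sl2_form x y else 0)) v"
proof -
  obtain x1 x2 x3 y1 y2 y3 where xy: "x = (x1, x2, x3)" "y = (y1, y2, y3)" by (metis prod.exhaust)
  have e_h: "commutator (e m) (h n) v = - scale 2 (e (m + n) v)" for v
    using commutator_skew[of "e m" "h n" v] by (simp add: h_e add.commute)
  have f_h: "commutator (f m) (h n) v = scale 2 (f (m + n) v)" for v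
    using commutator_skew[of "f m" "h n" v] by (simp add: h_f add.commute)
  have f_e: "commutator (f m) (e n) v =
      - h (m + n) v + scale (if m + n = 0 then of_int m * kappa else 0) v" for v
  proof (cases "m + n = 0")
    case True
    then have "n = - m" by simp
    then show ?thesis using commutator_skew[of "f m" "e n" v] by (simp add: e_f)
  next
    case False
    then show ?thesis using commutator_skew[of "f m" "e n" v] by (simp add: e_f add.commute[of n m])
  qed
  have l: "linear_op (\<lambda>v. scale y1 (e n v) + scale y2 (h n v) + scale y3 (f n v))"
    using linear_mode[of y n] by (simp add: mode_def[abs_def] xy)
  have "commutator (mode x m) (mode y n) v =
      scale x1 (scale y2 (- scale 2 (e (m + n) v)) +
        scale y3 (h (m + n) v + scale (if m + n = 0 then of_int m * kappa else 0) v)) +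
      scale x2 (scale y1 (scale 2 (e (m + n) v)) +
        scale y2 (scale (if m + n = 0 then 2 * of_int m * kappa else 0) v) +
        scale y3 (scale (-2) (f (m + n) v))) +
      scale x3 (scale y1 (- h (m + n) v + scale (if m + n = 0 then of_int m * kappa else 0) v) +
        scale y2 (scale 2 (f (m + n) v)))"
    unfolding mode_def[abs_def] xy fst_conv snd_conv commutator_left[OF l] commutator_right[OF linear_e]
      commutator_right[OF linear_h] commutator_right[OF linear_f] e_e f_f h_h h_e h_f e_f e_h f_h f_e
    by simp
  then show ?thesis
    by (cases "m + n = 0")
      (simp_all add: mode_def xy scale_right_distrib scale_left_distrib scale_left_diff_distrib
        scale_right_diff_distrib mult.commute mult.left_commute ring_distribs add_diff_eq diff_add_eq
        diff_diff_eq diff_eq_eq eq_diff_eq add_ac, simp_all only: mult.assoc)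
qed

definition loop_action :: "(int \<Rightarrow>\<^sub>0 sl2) \<Rightarrow> 'v \<Rightarrow> 'v" where
  "loop_action p v = (\<Sum>n\<in>Poly_Mapping.keys p. mode (Poly_Mapping.lookup p n) n v)"

lemma loop_action_superset:
  assumes "finite S" "Poly_Mapping.keys p \<subseteq> S"
  shows "loop_action p v = (\<Sum>n\<in>S. mode (Poly_Mapping.lookup p n) n v)"
  unfolding loop_action_def using assms
  by (intro sum.mono_neutral_left) (auto simp: in_keys_iff mode_zero)

lemma linear_loop_action: "linear_op (loop_action p)"
  by (rule linear_opI)
    (simp_all add: loop_action_def linear_op_simps[OF linear_mode] sum.distrib scale_sum_right)

lemma loop_action_add: "loop_action (p + q) v = loop_action p v + loop_action q v"
proof -
  let ?S = "Poly_Mapping.keys p \<union> Poly_Mapping.keys q"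
  have "loop_action r v = (\<Sum>n\<in>?S. mode (Poly_Mapping.lookup r n) n v)"
    if "Poly_Mapping.keys r \<subseteq> ?S" for r
    using that by (intro loop_action_superset) auto
  then show ?thesis using keys_add[of p q]
    by (simp add: lookup_add mode_add sum.distrib)
qed

lemma loop_action_zero: "loop_action 0 v = 0"
  by (simp add: loop_action_def)

lemma loop_action_sum: "loop_action (sum F S) v = (\<Sum>i\<in>S. loop_action (F i) v)"
  by (induction S rule: infinite_finite_induct) (simp_all add: loop_action_zero loop_action_add)

lemma loop_action_single: "loop_action (Poly_Mapping.single n x) v = mode x n v"
  by (subst loop_action_superset[of "{n}"]) auto

lemma loop_action_scale: "loop_action (Poly_Mapping.map (sl2_scale s) p) v = scale s (loop_action p v)"
proof -
  have 0: "sl2_scale s 0 = 0" by (simp add: zero_prod_def)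
  have "Poly_Mapping.lookup (Poly_Mapping.map (sl2_scale s) p) n = sl2_scale s (Poly_Mapping.lookup p n)" for n
    by (simp add: Poly_Mapping.map.rep_eq 0 when_def)
  moreover from this have "Poly_Mapping.keys (Poly_Mapping.map (sl2_scale s) p) \<subseteq> Poly_Mapping.keys p"
    by (auto simp: in_keys_iff 0)
  then have "loop_action (Poly_Mapping.map (sl2_scale s) p) v =
      (\<Sum>n\<in>Poly_Mapping.keys p. mode (Poly_Mapping.lookup (Poly_Mapping.map (sl2_scale s) p) n) n v)"
    by (intro loop_action_superset) simp_all
  ultimately show ?thesis
    by (simp add: loop_action_def[of p] mode_scale scale_sum_right)
qed

definition aff_action :: "affine_sl2 \<Rightarrow> 'v \<Rightarrow> 'v" where
  "aff_action X v = loop_action (fst X) v + scale (kappa * snd X) v"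

lemma loop_action_bracket:
  "commutator (loop_action p) (loop_action q) v = aff_action (aff_bracket (p, r) (q, s)) v"
proof -
  let ?p = "Poly_Mapping.lookup p" and ?q = "Poly_Mapping.lookup q"
  let ?P = "Poly_Mapping.keys p" and ?Q = "Poly_Mapping.keys q"
  have form: "(\<Sum>m\<in>?Q. kappa * (if n + m = 0 then of_int n * sl2_form (?p n) (?q m) else 0)) =
      kappa * (of_int n * sl2_form (?p n) (?q (- n)))" for n
  proof -
    \<comment> \<open>if \<open>- n\<close> is not a key of \<open>q\<close>, both sides vanish because \<open>?q (- n) = 0\<close>\<close>
    have "(\<Sum>m\<in>?Q. kappa * (if n + m = 0 then of_int n * sl2_form (?p n) (?q m) else 0)) =
        (\<Sum>m\<in>?Q. if m = - n then kappa * (of_int n * sl2_form (?p n) (?q (- n))) else 0)"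
      by (rule sum.cong) (auto simp: add_eq_0_iff)
    then show ?thesis by (simp add: in_keys_iff)
  qed
  have "commutator (loop_action p) (loop_action q) v =
      (\<Sum>n\<in>?P. \<Sum>m\<in>?Q. commutator (mode (?p n) n) (mode (?q m) m) v)"
    unfolding commutator_def sum_subtractf
    by (simp add: loop_action_def linear_op_simps[OF linear_mode] sum.swap[of _ ?Q ?P])
  also have "\<dots> = (\<Sum>n\<in>?P. (\<Sum>m\<in>?Q. mode (sl2_bracket (?p n) (?q m)) (n + m) v)
      + scale (kappa * (of_int n * sl2_form (?p n) (?q (- n)))) v)"
    by (simp only: mode_bracket sum.distrib scale_sum_left[symmetric] form)
  also have "\<dots> = aff_action (aff_bracket (p, r) (q, s)) v"
    by (simp add: aff_action_def loop_action_sum loop_action_single sum.distrib scale_sum_left sum_distrib_left)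
  finally show ?thesis .
qed

theorem affine_sl2_module_aff_action: "affine_sl2_module scale aff_action"
proof (intro affine_sl2_module.intro affine_sl2_module_axioms.intro vector_space_axioms)
  fix X Y :: affine_sl2 and s :: complex and v
  show "linear_op (aff_action X)"
    unfolding aff_action_def[abs_def]
    by (rule linear_op_intros(1)[OF linear_loop_action linear_op_trivial(2)])
  show "aff_action (X + Y) v = aff_action X v + aff_action Y v"
    by (simp add: aff_action_def loop_action_add algebra_simps)
  show "aff_action (aff_scale s X) v = scale s (aff_action X v)"
    by (cases X) (simp add: aff_action_def loop_action_scale algebra_simps)
  have "aff_action (aff_bracket X Y) v = commutator (loop_action (fst X)) (loop_action (fst Y)) v"
    by (cases X; cases Y) (simp only: loop_action_bracket[symmetric] fst_conv)
  also have "\<dots> = aff_action X (aff_action Y v) - aff_action Y (aff_action X v)"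
    by (simp add: aff_action_def commutator_def linear_op_simps[OF linear_loop_action] algebra_simps)
  finally show "aff_action (aff_bracket X Y) v = aff_action X (aff_action Y v) - aff_action Y (aff_action X v)" .
qed

lemma has_level_aff_action: "has_level scale aff_action kappa"
  by (simp add: has_level_def aff_action_def aff_c_def loop_action_zero)

lemma current_aff_action:
  "current aff_action sl2_e k = e (- k - 1)" "current aff_action sl2_h k = h (- k - 1)"
  "current aff_action sl2_f k = f (- k - 1)"
  by (auto simp: fun_eq_iff current_def aff_action_def aff_elem_def loop_action_single mode_def
      sl2_e_def sl2_h_def sl2_f_def)

end

section \<open>The Wakimoto module\<close>

theorem theorem1p2:
  fixes scale :: "complex \<Rightarrow> 'v::ab_group_add \<Rightarrow> 'v"
    and a astar :: "int \<Rightarrow> 'v \<Rightarrow> 'v"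
    and v\<^sub>1 :: 'v
    and lam mu :: complex
    and chi :: "complex fls"
  assumes "M1 scale a astar v\<^sub>1 lam mu"
    and "lam \<noteq> 0"
  shows "\<exists>\<rho> :: affine_sl2 \<Rightarrow> 'v \<Rightarrow> 'v.
    affine_sl2_module scale \<rho> \<and>
    has_level scale \<rho> (-2) \<and>
    simple_under scale (range \<rho>) \<and>
    current \<rho> sl2_e = a_field a \<and>
    current \<rho> sl2_h =
      (\<lambda>k v. scale (-2) (normal_ordered a astar 1 k v) + fd_scalar scale chi k v) \<and>
    current \<rho> sl2_f =
      (\<lambda>k v. - normal_ordered a astar 2 k v
              - scale 2 (fd_deriv scale (astar_field astar) k v)
              + fd_mult (astar_field astar) (fd_scalar scale chi) k v)"
proof -
  interpret M1 scale a astar v\<^sub>1 lam mu by (rule assms(1))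
  let ?e = "\<lambda>n. \<alpha> (- n - 1)" and ?h = "\<lambda>n. wak_h chi (- n - 1)" and ?f = "\<lambda>n. wak_f chi (- n - 1)"
  have i: "- m - 1 + (- n - 1) + 1 = - (m + n) - 1" "- n - 1 + (- m - 1) + 1 = - (m + n) - 1"
    "(- m - 1 + (- n - 1) = -2) = (m + n = 0)" for m n :: int by auto
  interpret affine_sl2_currents scale ?e ?h ?f "-2"
  proof (intro affine_sl2_currents.intro affine_sl2_currents_axioms.intro complex_vector_space_axioms)
    fix m n v
    show "commutator (?e m) (?e n) v = 0"
      using alpha_alpha by (simp add: commutator_def)
    show "commutator (?f m) (?f n) v = 0" by (rule wak_f_wak_f)
    show "commutator (?h m) (?h n) v = scale (if m + n = 0 then 2 * of_int m * (-2) else 0) v"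
      unfolding wak_h_wak_h i(3) by (cases "m + n = 0") (simp_all add: algebra_simps)
    have "commutator (?h m) (?e n) v = - commutator (?e n) (?h m) v" by (rule commutator_skew)
    also have "\<dots> = scale 2 (?e (m + n) v)" unfolding alpha_wak_h i(1) by simp
    finally show "commutator (?h m) (?e n) v = scale 2 (?e (m + n) v)" .
    show "commutator (?h m) (?f n) v = scale (-2) (?f (m + n) v)"
      unfolding wak_h_wak_f i(1) ..
    show "commutator (?e m) (?f n) v = ?h (m + n) v + scale (if m + n = 0 then of_int m * (-2) else 0) v"
      unfolding alpha_wak_f i(2,3) by (cases "m + n = 0") (simp_all add: mult.commute)
  qed (rule linear_alpha linear_wak_h linear_wak_f)+
  have currents: "current aff_action sl2_e = \<alpha>" "current aff_action sl2_h = wak_h chi"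
    "current aff_action sl2_f = wak_f chi"
    by (simp_all add: fun_eq_iff current_aff_action)
  have "current aff_action x k \<in> range aff_action" for x k by (simp add: current_def)
  from this[of sl2_e] this[of sl2_h]
  have range: "\<alpha> k \<in> range aff_action" "wak_h chi k \<in> range aff_action" for k
    unfolding currents by blast+
  have "simple_under scale (range aff_action)"
  proof (rule simple_under_alpha_b[OF assms(2) range(1)])
    fix W k w assume W: "invariant_subspace scale (range aff_action) W" and w: "w \<in> W"
    then have sub: "subspace W" by (simp add: invariant_subspace_def)
    have h: "wak_h chi k w \<in> W"
      using W range(2)[of k] w unfolding invariant_subspace_def by blast
    have "b k w = scale (-1/2) (wak_h chi k w - scale (fls_nth chi k) w)"
      by (simp add: wak_h_def fd_scalar_def)
    then show "b k w \<in> W"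
      using subspace_scale[OF sub subspace_diff[OF sub h subspace_scale[OF sub w]]] by (simp only:)
  qed
  moreover have "fd_power \<beta> 1 = \<beta>" "fd_power \<beta> 2 = \<gamma>"
    by (simp_all add: numeral_2_eq_2 fd_mult_one_right[OF is_field_beta])
  then have "wak_h chi = (\<lambda>k v. scale (-2) (normal_ordered a astar 1 k v) + fd_scalar scale chi k v)"
    "wak_f chi = (\<lambda>k v. - normal_ordered a astar 2 k v - scale 2 (fd_deriv scale \<beta> k v)
        + fd_mult \<beta> (fd_scalar scale chi) k v)"
    by (simp_all add: wak_h_def[abs_def] wak_f_def[abs_def] normal_ordered_eq)
  ultimately show ?thesis
    using affine_sl2_module_aff_action has_level_aff_action currents
    by (intro exI[of _ aff_action]) simp
qed

end
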